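(* Let $f_i=\check{1_{W_i}}$ for $1\leqslant i\leqslant N$ and $f(y)=(f_1(y),\ldots,f_N(y))^T$ for $y\in\mathbb{R}^{d-1}$. Under inverse Fourier transform, the system of equations $1_{W_i}=\sum_{j=1}^N\sum_{t\in T_{ij}}1_{QW_j+t^\star}$ (valid Lebesgue-almost everywhere, for $1\leqslant i\leqslant N$) becomes $$f(y)=\lambda^{-1}\,\underline{B}(y)\,f(Ry),\qquad y\in\mathbb{R}^{d-1},$$ with $R=Q^T$ and $\underline{B}_{ij}(y)=\sum_{x\in T_{ij}}e^{2\pi\mathrm{i}\langle x^\star|y\rangle}$, and all $f_i$ are continuous.
   Context: Setting. Let $\varrho$ be a primitive substitution on the alphabet $\{a_1,\ldots,a_N\}$ with substitution matrix $M$, where $M_{ij}$ is the number of letters $a_i$ in $\varrho(a_j)$. Let $\lambda$ be the Perron–Frobenius (PF) eigenvalue of $M$, assumed to be a Pisot–Vijayaraghavan (PV) unit of degree $d\leqslant N$: $\lambda>1$ is an algebraic integer and a unit, and all its other algebraic conjugates have modulus $<1$. The characteristic polynomial of $M$ need not be irreducible. Let $u=(u_1,\ldots,u_N)$ be a strictly positive left PF eigenvector of $M$. Geometric realisation. Letter $a_i$ is realised as an interval (tile) of length $\ell_i=c\,u_i$ with a constant $c>0$ chosen such that all control points (left endpoints of tiles), relative to one of them placed at $0$, lie in $\mathbb{Z}[\lambda]$, but in no proper $\lambda$-invariant submodule of it. For $1\leqslant i,j\leqslant N$, $T_{ij}\subset\mathbb{Z}[\lambda]$ is the finite set of positions of the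 left endpoints of the tiles of type $a_i$ in the supertile $\varrho(a_j)$ (of length $\lambda\ell_j$, left endpoint at $0$), so $\operatorname{card}(T_{ij})=M_{ij}$. Star map. Let $\kappa_1=\mathrm{id},\kappa_2,\ldots,\kappa_r$ be the real embeddings of $\mathbb{Q}(\lambda)$ and $\sigma_1,\overline{\sigma_1},\ldots,\sigma_s,\overline{\sigma_s}$ the complex ones, $d=r+2s$. For $x\in\mathbb{Z}[\lambda]$, put $x^\star=(\kappa_2(x),\ldots,\kappa_r(x),\operatorname{Re}\sigma_1(x),\operatorname{Im}\sigma_1(x),\ldots,\operatorname{Re}\sigma_s(x),\operatorname{Im}\sigma_s(x))\in\mathbb{R}^{d-1}$. Let $Q$ be the linear map on $\mathbb{R}^{d-1}$ with $(\lambda x)^\star=Qx^\star$, i.e. $Q=\operatorname{diag}(\kappa_2(\lambda),\ldots,\kappa_r(\lambda))\oplus\bigoplus_{i=1}^s\begin{pmatrix}\operatorname{Re}\sigma_i(\lambda)&-\operatorname{Im}\sigma_i(\lambda)\\ \operatorname{Im}\sigma_i(\lambda)&\operatorname{Re}\sigma_i(\lambda)\end{pmatrix}$; one has $|\det(Q)|=\lambda^{-1}$. Windows. $(W_1,\ldots,W_N)$ is the unique $N$-tuple of non-empty compact subsets of $\mathbb{R}^{d-1}$ with $W_i=\bigcup_{j=1}^N\bigcup_{t\in T_{ij}}(QW_j+t^\star)$ for $1\leqslant i\leqslant N$. It is known that, for each $i$, distinct sets on the right-hand side intersect at most in a Lebesgue-null set. $1_K$ is the characteristic function of $K$, and $\check{g}(y)=\int_{\mathbb{R}^{d-1}}e^{2\pi\mathrm{i}\langle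 x|y\rangle}g(x)\,\mathrm{d}x$ is the inverse Fourier transform. *)

theory Defs
  imports "HOL-Analysis.Analysis" "HOL-Computational_Algebra.Computational_Algebra"
    "HOL-Library.Sublist"
begin

section \<open>Substitutions\<close>

text \<open>The alphabet is a finite type \<open>'n\<close>, so \<open>N = CARD('n)\<close>; a substitution maps letters to words.\<close>

definition subst_word :: "('n \<Rightarrow> 'n list) \<Rightarrow> 'n list \<Rightarrow> 'n list" where
  "subst_word \<rho> v = concat (map \<rho> v)"

definition primitive_subst :: "('n \<Rightarrow> 'n list) \<Rightarrow> bool" where
  "primitive_subst \<rho> \<longleftrightarrow> (\<exists>k\<ge>1. \<forall>i j. i \<in> set ((subst_word \<rho> ^^ k) [j]))"

definition subst_matrix :: "('n::finite \<Rightarrow> 'n list) \<Rightarrow> real ^ 'n ^ 'n" where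
  "subst_matrix \<rho> = (\<chi> i j. real (count_list (\<rho> j) i))"

definition legal_word :: "('n \<Rightarrow> 'n list) \<Rightarrow> 'n list \<Rightarrow> bool" where
  "legal_word \<rho> v \<longleftrightarrow> (\<exists>k a. sublist v ((subst_word \<rho> ^^ k) [a]))"

definition subst_hull :: "('n \<Rightarrow> 'n list) \<Rightarrow> (int \<Rightarrow> 'n) set" where
  "subst_hull \<rho> = {w. \<forall>m n. legal_word \<rho> (map (\<lambda>k. w (m + int k)) [0..<n])}"

definition pf_eigenvalue :: "real ^ 'n ^ 'n \<Rightarrow> real \<Rightarrow> bool" where
  "pf_eigenvalue M lam \<longleftrightarrow>
     (\<exists>v. v \<noteq> 0 \<and> M *v v = lam *s v) \<and>
     (\<forall>\<mu>::complex. (\<exists>v. v \<noteq> 0 \<and> (\<chi> i j. complex_of_real (M $ i $ j)) *v v = \<mu> *s v)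
         \<longrightarrow> cmod \<mu> \<le> lam)"


section \<open>Pisot units and the field they generate\<close>

definition min_poly :: "real \<Rightarrow> rat poly" where
  "min_poly x =
     (THE p. lead_coeff p = 1 \<and> irreducible p \<and> poly (map_poly of_rat p) x = 0)"

text \<open>An algebraic integer is a unit (in the ring of algebraic integers) iff its inverse is
  again an algebraic integer.\<close>

definition pisot_unit :: "real \<Rightarrow> bool" where
  "pisot_unit lam \<longleftrightarrow>
     lam > 1 \<and> algebraic_int lam \<and> algebraic_int (inverse lam) \<and>
     (\<forall>z::complex. poly (map_poly of_rat (min_poly lam)) z = 0 \<and> z \<noteq> of_real lam \<longrightarrow> cmod z < 1)"

definition int_adjoin :: "real \<Rightarrow> real set" where
  "int_adjoin x = {poly (map_poly of_int p) x | p. True}"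

definition rat_adjoin :: "real \<Rightarrow> real set" where
  "rat_adjoin x = {poly (map_poly of_rat p) x / poly (map_poly of_rat q) x | p q.
     poly (map_poly of_rat q) x \<noteq> 0}"

text \<open>Embeddings are taken extensional (undefined outside \<open>K\<close>), so that two embeddings
  are equal iff they agree on \<open>K\<close>.\<close>

definition field_embeddings :: "real set \<Rightarrow> (real \<Rightarrow> 'b::field) set" where
  "field_embeddings K = {\<tau> \<in> extensional K.
     \<tau> 1 = 1 \<and> (\<forall>x\<in>K. \<forall>y\<in>K. \<tau> (x + y) = \<tau> x + \<tau> y \<and> \<tau> (x * y) = \<tau> x * \<tau> y)}"

definition real_embeddings :: "real set \<Rightarrow> (real \<Rightarrow> real) set" where
  "real_embeddings K = field_embeddings K"

definition nonreal_embeddings :: "real set \<Rightarrow> (real \<Rightarrow> complex) set" where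
  "nonreal_embeddings K = {\<tau> \<in> field_embeddings K. \<not> \<tau> ` K \<subseteq> \<real>}"

text \<open>\<open>\<kappa> 1 = id, \<dots>, \<kappa> r\<close> lists the real embeddings and
  \<open>\<sigma> 1, cnj \<circ> \<sigma> 1, \<dots>, \<sigma> s, cnj \<circ> \<sigma> s\<close> the non-real ones, without repetition.\<close>

definition embedding_list ::
    "real set \<Rightarrow> nat \<Rightarrow> (nat \<Rightarrow> real \<Rightarrow> real) \<Rightarrow> nat \<Rightarrow> (nat \<Rightarrow> real \<Rightarrow> complex) \<Rightarrow> bool" where
  "embedding_list K r \<kappa> s \<sigma> \<longleftrightarrow>
     bij_betw \<kappa> {1..r} (real_embeddings K) \<and> 1 \<le> r \<and> \<kappa> 1 = restrict id K \<and>
     bij_betw (\<lambda>(i, conj). if conj then restrict (cnj \<circ> \<sigma> i) K else \<sigma> i)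
       ({1..s} \<times> {False, True}) (nonreal_embeddings K)"


section \<open>Star map\<close>

text \<open>Internal space is \<open>real ^ 'm\<close> with \<open>CARD('m) = d - 1\<close>. The bijection
  \<open>e\<close> from \<open>'m\<close> onto \<open>{1..d-1}\<close> fixes the order of the coordinates:
  \<open>1, \<dots>, r - 1\<close> belong to \<open>\<kappa> 2, \<dots>, \<kappa> r\<close>, and the remaining ones are consecutive pairs
  of real and imaginary parts of \<open>\<sigma> 1, \<dots>, \<sigma> s\<close>.\<close>

definition star_map ::
    "('m::finite \<Rightarrow> nat) \<Rightarrow> nat \<Rightarrow> (nat \<Rightarrow> real \<Rightarrow> real) \<Rightarrow> (nat \<Rightarrow> real \<Rightarrow> complex) \<Rightarrow> real \<Rightarrow> real ^ 'm"
  where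
  "star_map e r \<kappa> \<sigma> x = (\<chi> a.
     if e a < r then \<kappa> (e a + 1) x
     else let k = e a - r in
       if even k then Re (\<sigma> (k div 2 + 1) x) else Im (\<sigma> (k div 2 + 1) x))"

definition star_matrix ::
    "('m::finite \<Rightarrow> nat) \<Rightarrow> nat \<Rightarrow> (nat \<Rightarrow> real \<Rightarrow> real) \<Rightarrow> (nat \<Rightarrow> real \<Rightarrow> complex) \<Rightarrow> real \<Rightarrow> real ^ 'm ^ 'm"
  where
  "star_matrix e r \<kappa> \<sigma> lam = (\<chi> a b.
     if e a < r \<or> e b < r then (if a = b then \<kappa> (e a + 1) lam else 0)
     else let k = e a - r; l = e b - r; z = \<sigma> (k div 2 + 1) lam in
       if k div 2 \<noteq> l div 2 then 0
       else if k = l then Re z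
       else if even k then - Im z
       else Im z)"


section \<open>Geometric realisation\<close>

text \<open>Left endpoints of the tiles in the realisation of a bi-infinite word, with the
  left endpoint of tile number \<open>0\<close> placed at the origin.\<close>

definition control_points :: "real ^ 'n \<Rightarrow> (int \<Rightarrow> 'n) \<Rightarrow> real set" where
  "control_points len w = range (\<lambda>n::int. (\<Sum>k\<in>{0..<n}. len $ w k) - (\<Sum>k\<in>{n..<0}. len $ w k))"

definition invariant_submodule :: "real \<Rightarrow> real set \<Rightarrow> bool" where
  "invariant_submodule lam S \<longleftrightarrow>
     S \<subseteq> int_adjoin lam \<and> 0 \<in> S \<and> (\<forall>x\<in>S. \<forall>y\<in>S. x - y \<in> S) \<and> (\<forall>x\<in>S. lam * x \<in> S)"

definition generic_points :: "real \<Rightarrow> real set \<Rightarrow> bool" where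
  "generic_points lam P \<longleftrightarrow>
     P \<subseteq> int_adjoin lam \<and> (\<forall>S. invariant_submodule lam S \<and> P \<subseteq> S \<longrightarrow> S = int_adjoin lam)"

definition tile_positions ::
    "('n \<Rightarrow> 'n list) \<Rightarrow> real ^ 'n \<Rightarrow> 'n \<Rightarrow> 'n \<Rightarrow> real set" where
  "tile_positions \<rho> len i j =
     {sum_list (map (($) len) (take k (\<rho> j))) | k. k < length (\<rho> j) \<and> \<rho> j ! k = i}"


section \<open>Windows and Fourier transform\<close>

definition window_system ::
    "real ^ 'm ^ 'm \<Rightarrow> ('n \<Rightarrow> 'n \<Rightarrow> (real ^ 'm) set) \<Rightarrow> ('n \<Rightarrow> (real ^ 'm) set) \<Rightarrow> bool" where
  "window_system Q D W \<longleftrightarrow>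
     (\<forall>i. compact (W i) \<and> W i \<noteq> {}) \<and>
     (\<forall>i. W i = (\<Union>j. \<Union>v\<in>D i j. (\<lambda>x. Q *v x + v) ` W j))"

definition inverse_fourier :: "(real ^ 'm \<Rightarrow> complex) \<Rightarrow> real ^ 'm \<Rightarrow> complex" where
  "inverse_fourier g y = (LINT x|lborel. exp (2 * pi * \<i> * complex_of_real (x \<bullet> y)) * g x)"

definition fourier_matrix ::
    "('n::finite \<Rightarrow> 'n \<Rightarrow> real set) \<Rightarrow> (real \<Rightarrow> real ^ 'm) \<Rightarrow> real ^ 'm \<Rightarrow> complex ^ 'n ^ 'n" where
  "fourier_matrix T st y =
     (\<chi> i j. \<Sum>x\<in>T i j. exp (2 * pi * \<i> * complex_of_real (st x \<bullet> y)))"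

end

(* Volumes: |det Q| = 1/lam and card T_ij <= M_ij give lam vol(W_i) <= (M vol(W))_i. Pairing with
   the strictly positive left eigenvector u of M turns all these inequalities into equalities, so
   the pieces of each W_i overlap only in null sets. The functional equation is then the affine
   change of variables in the Fourier integral of each piece.

   The value of |det Q|: the embeddings of Q(lam) correspond to the complex roots of the minimal
   polynomial, and the product of their moduli is its absolute constant term, which is 1 by
   Gauss's lemma since lam is a unit. *)

theory Submission
  imports Defs "HOL-Computational_Algebra.Field_as_Ring"
begin

text \<open>The identity embedding is the one conjugate without a coordinate in internal space. Its
  factor in the norm is \<open>lam\<close>, so the remaining moduli multiply to
  \<open>1/lam\<close>. The pairing works because \<open>u v* M = lam *s u\<close> makes the sum of
  \<open>u_i ((1/lam) (M vol(W))_i - vol(W_i))\<close> vanish, while each bracket bounds from above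
  the volume lost to overlaps in \<open>W_i\<close>. Subadditivity of volume and the bound on the
  number of tiles point in the same direction, so no term can be positive. Internal space has an
  arbitrary finite index type. The behaviour of Lebesgue measure under matrices is obtained on a
  well-ordered copy of that type and carried over by relabelling coordinates, which changes neither
  Lebesgue measure nor determinants.\<close>

no_notation fps_nth (infixl "$" 75)

section \<open>Linear changes of variables in Lebesgue integrals\<close>



text \<open>Conjugation by \<open>h\<close> matches the permutations of the two index types,
  preserves signs, and only reorders the factors of each product in the Leibniz expansion.\<close>

lemma det_reindex:
  fixes A :: "'c::comm_ring_1 ^ 'a::finite ^ 'a" and h :: "'b::finite \<Rightarrow> 'a"
  assumes h: "bij h"
  shows "det (\<chi> i j. A $ h i $ h j) = det A"
proof -
  define g where "g p = h \<circ> p \<circ> inv h" for p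
  have gp: "g p = map_permutation UNIV h p" for p
    using h by (auto simp: g_def map_permutation_def restrict_id_def bij_is_surj)
  have hi: "inv h (h x) = x" "h (inv h y) = y" for x y
    using h by (simp_all add: bij_is_inj bij_is_surj surj_f_inv_f)
  show ?thesis
    unfolding det_def
  proof (rule sum.reindex_bij_witness[where j = g and i = "\<lambda>q. inv h \<circ> q \<circ> h"])
    fix p :: "'b \<Rightarrow> 'b" assume "p \<in> {p. p permutes UNIV}"
    then have p: "p permutes UNIV" by simp
    show "inv h \<circ> g p \<circ> h = p" by (auto simp: g_def hi)
    show "g p \<in> {p. p permutes UNIV}"
      using h p by (auto simp: g_def permutes_bij intro!: bij_imp_permutes bij_comp bij_imp_bij_inv)
    have "sign (g p) = sign p"
      unfolding gp using p h by (intro sign_map_permutation) (auto simp: bij_is_inj)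
    moreover have "(\<Prod>i\<in>UNIV. A $ i $ g p i) = (\<Prod>i\<in>UNIV. A $ h i $ h (p i))"
      using h by (intro prod.reindex_bij_witness[where i = h and j = "inv h"]) (auto simp: g_def hi)
    ultimately show "of_int (sign (g p)) * (\<Prod>i\<in>UNIV. A $ i $ g p i) =
        of_int (sign p) * (\<Prod>i\<in>UNIV. (\<chi> i j. A $ h i $ h j) $ i $ p i)"
      by simp
  next
    fix q :: "'a \<Rightarrow> 'a" assume "q \<in> {p. p permutes UNIV}"
    then have q: "q permutes UNIV" by simp
    show "g (inv h \<circ> q \<circ> h) = q" by (auto simp: g_def hi)
    show "inv h \<circ> q \<circ> h \<in> {p. p permutes UNIV}"
      using h q by (auto simp: permutes_bij intro!: bij_imp_permutes bij_comp bij_imp_bij_inv)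
  qed
qed

lemma prod_Basis_vec:
  fixes f :: "real ^ 'a::finite \<Rightarrow> 'c::comm_monoid_mult"
  shows "(\<Prod>b\<in>Basis. f b) = (\<Prod>i\<in>UNIV. f (axis i 1))"
proof -
  have "Basis = range (\<lambda>i::'a. axis i (1::real))"
    by (auto simp: Basis_vec_def)
  moreover have "inj (\<lambda>i::'a. axis i (1::real))"
    by (auto simp: inj_on_def axis_eq_axis)
  ultimately show ?thesis
    using prod.reindex[of "\<lambda>i::'a. axis i (1::real)" UNIV f] by simp
qed

text \<open>Boxes determine Lebesgue measure, and a relabelling of coordinates pulls a box back to a
  box with the same side lengths in another order.\<close>

lemma lborel_distr_reindex:
  fixes h :: "'a::finite \<Rightarrow> 'b::finite"
  assumes h: "bij h"
  shows "distr lborel borel (\<lambda>x::real^'b. \<chi> i::'a. x $ h i) = lborel"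
proof (rule lborel_eqI[symmetric])
  let ?P = "\<lambda>x::real^'b. \<chi> i::'a. x $ h i"
  let ?I = "\<lambda>x::real^'a. \<chi> i::'b. x $ inv h i"
  have hi: "inv h (h x) = x" "h (inv h y) = y" for x y
    using h by (simp_all add: bij_is_inj bij_is_surj surj_f_inv_f)
  have P [measurable]: "?P \<in> borel_measurable borel"
    by (intro borel_measurable_continuous_onI continuous_intros)
  fix l u :: "real^'a" assume le: "\<And>b. b \<in> Basis \<Longrightarrow> l \<bullet> b \<le> u \<bullet> b"
  have le': "l $ i \<le> u $ i" for i
    using le[of "axis i 1"] by (auto simp: Basis_vec_def inner_axis)
  have "?P -` box l u = box (?I l) (?I u)"
  proof -
    have "(\<forall>j. S (inv h j) j) \<longleftrightarrow> (\<forall>i. S i (h i))" for S :: "'a \<Rightarrow> 'b \<Rightarrow> bool"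
      by (metis hi)
    from this[of "\<lambda>i j. l $ i < x $ j \<and> x $ j < u $ i" for x]
    have "?P x \<in> box l u \<longleftrightarrow> x \<in> box (?I l) (?I u)" for x
      by (simp add: mem_box_cart)
    then show ?thesis
      by (auto simp only: vimage_def)
  qed
  moreover have "(\<Prod>b\<in>Basis. (?I u - ?I l) \<bullet> b) = (\<Prod>b\<in>Basis. (u - l) \<bullet> b)"
  proof -
    have "(\<Prod>b\<in>Basis. (?I u - ?I l) \<bullet> b) = (\<Prod>i\<in>UNIV. (?I u - ?I l) $ i)"
      by (simp add: prod_Basis_vec inner_axis)
    also have "\<dots> = (\<Prod>i\<in>UNIV. (u - l) $ i)"
      using h by (intro prod.reindex_bij_witness[where i = h and j = "inv h"]) (auto simp: hi)
    also have "\<dots> = (\<Prod>b\<in>Basis. (u - l) \<bullet> b)"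
      by (simp add: prod_Basis_vec inner_axis)
    finally show ?thesis .
  qed
  moreover have "(?I l) \<bullet> b \<le> (?I u) \<bullet> b" if "b \<in> Basis" for b
    using that le' by (auto simp: Basis_vec_def inner_axis)
  ultimately show "emeasure (distr lborel borel ?P) (box l u) = (\<Prod>b\<in>Basis. (u - l) \<bullet> b)"
    by (simp add: emeasure_distr emeasure_lborel_box_eq)
qed simp

text \<open>The change of variables theorems of the library require a well-ordered index type.\<close>

typedef (overloaded) ('a::finite) ordered_index = "UNIV :: 'a set"
  by blast

instance ordered_index :: (finite) finite
proof
  have "finite (Abs_ordered_index ` (UNIV :: 'a set))"
    by (rule finite_imageI) (rule finite)
  then show "finite (UNIV :: 'a ordered_index set)"
    by (simp only: type_definition.Abs_image[OF type_definition_ordered_index])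
qed

text \<open>The order is pulled back along the injection \<open>to_nat\<close>, available because
  finite types are countable, so that well-foundedness is inherited from the naturals.\<close>

instantiation ordered_index :: (finite) wellorder
begin

definition less_eq_ordered_index :: "'a ordered_index \<Rightarrow> 'a ordered_index \<Rightarrow> bool" where
  "x \<le> y \<longleftrightarrow> to_nat (Rep_ordered_index x) \<le> to_nat (Rep_ordered_index y)"

definition less_ordered_index :: "'a ordered_index \<Rightarrow> 'a ordered_index \<Rightarrow> bool" where
  "x < y \<longleftrightarrow> to_nat (Rep_ordered_index x) < to_nat (Rep_ordered_index y)"

instance
proof
  fix x y z :: "'a ordered_index" and P :: "'a ordered_index \<Rightarrow> bool"
  show "x < y \<longleftrightarrow> x \<le> y \<and> \<not> y \<le> x" "x \<le> x" "x \<le> y \<or> y \<le> x"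
    unfolding less_eq_ordered_index_def less_ordered_index_def by linarith+
  show "x \<le> z" if "x \<le> y" "y \<le> z"
    using that unfolding less_eq_ordered_index_def by (rule order_trans)
  show "x = y" if "x \<le> y" "y \<le> x"
  proof -
    have "to_nat (Rep_ordered_index x) = to_nat (Rep_ordered_index y)"
      using that unfolding less_eq_ordered_index_def by linarith
    then have "Rep_ordered_index x = Rep_ordered_index y"
      by (rule injD[OF inj_to_nat])
    then show ?thesis
      by (rule iffD1[OF Rep_ordered_index_inject])
  qed
  show "P x" if "\<And>x. (\<And>y. y < x \<Longrightarrow> P y) \<Longrightarrow> P x"
    using that unfolding less_ordered_index_def by (rule measure_induct_rule)
qed

end

lemma bij_Rep_ordered_index: "bij Rep_ordered_index"
  by (intro bijI)
    (simp_all add: inj_def Rep_ordered_index_inject type_definition.Rep_range[OF type_definition_ordered_index])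

text \<open>On boxes: the preimage under \<open>A\<close> is the image under the inverse
  \<open>A'\<close>, whose volume carries the factor |det A'|, and the density cancels it. Stated
  for measures, the formula passes to all Bochner integrals at once.\<close>

lemma lborel_linear_wellorder:
  fixes A :: "real ^ 'n::{finite,wellorder} ^ 'n::{finite,wellorder}"
  assumes A: "det A \<noteq> 0"
  shows "lborel = density (distr lborel borel ((*v) A)) (\<lambda>_. ennreal \<bar>det A\<bar>)"
proof (rule lborel_eqI)
  have A_meas [measurable]: "(*v) A \<in> borel_measurable borel"
    by (intro borel_measurable_continuous_onI linear_continuous_on matrix_vector_mul_bounded_linear)
  obtain A' where inv': "A ** A' = mat 1" "A' ** A = mat 1"
    using A invertible_det_nz[of A] by (auto simp: invertible_def)
  have "det A * det A' = 1"
    using inv' by (metis det_I det_mul)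
  then have dd: "\<bar>det A\<bar> * \<bar>det A'\<bar> = 1"
    by (metis abs_mult abs_one)
  fix l u :: "real^'n::{finite,wellorder}" assume le: "\<And>b. b \<in> Basis \<Longrightarrow> l \<bullet> b \<le> u \<bullet> b"
  have vim: "(*v) A -` box l u = (*v) A' ` box l u"
  proof -
    have "A' *v (A *v x) = x" "A *v (A' *v x) = x" for x
      by (simp_all add: matrix_vector_mul_assoc inv')
    then show ?thesis
      by (auto intro: image_eqI[OF sym])
  qed
  have im: "(*v) A' ` box l u \<in> lmeasurable"
    by (intro measurable_linear_image) auto
  have "emeasure lborel ((*v) A -` box l u) = emeasure lebesgue ((*v) A' ` box l u)"
    unfolding vim[symmetric] using measurable_sets_borel[OF A_meas, of "box l u"] by simp
  also have "\<dots> = measure lebesgue ((*v) A' ` box l u)"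
    using im by (simp add: emeasure_eq_measure2)
  also have "\<dots> = \<bar>det A'\<bar> * measure lebesgue (box l u)"
    by (subst measure_linear_image) auto
  also have "measure lebesgue (box l u) = (\<Prod>b\<in>Basis. (u - l) \<bullet> b)"
    using le by (simp add: measure_completion measure_lborel_box_eq)
  finally have "emeasure lborel ((*v) A -` box l u)
      = ennreal (\<bar>det A'\<bar> * (\<Prod>b\<in>Basis. (u - l) \<bullet> b))" .
  then have "emeasure (density (distr lborel borel ((*v) A)) (\<lambda>_. ennreal \<bar>det A\<bar>)) (box l u)
      = ennreal (\<bar>det A\<bar> * \<bar>det A'\<bar> * (\<Prod>b\<in>Basis. (u - l) \<bullet> b))"
    by (simp add: emeasure_density_const emeasure_distr ennreal_mult' mult.assoc)
  then show "emeasure (density (distr lborel borel ((*v) A)) (\<lambda>_. ennreal \<bar>det A\<bar>)) (box l u)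
      = (\<Prod>b\<in>Basis. (u - l) \<bullet> b)"
    by (simp add: dd)
qed simp

text \<open>\<open>A\<close> factors as relabelling, the relabelled matrix, and relabelling back.
  The outer maps preserve Lebesgue measure and the middle one has the determinant of
  \<open>A\<close>, so the well-ordered case applies.\<close>

lemma lborel_linear:
  fixes A :: "real ^ 'n ^ 'n::finite"
  assumes A: "det A \<noteq> 0"
  shows "lborel = density (distr lborel borel ((*v) A)) (\<lambda>_. ennreal \<bar>det A\<bar>)"
proof (rule measure_eqI)
  let ?h = "Rep_ordered_index :: 'n ordered_index \<Rightarrow> 'n"
  let ?A = "(\<chi> i j. A $ ?h i $ ?h j) :: real ^ 'n ordered_index ^ 'n ordered_index"
  define P where "P = (\<lambda>x::real^'n. \<chi> i. x $ ?h i)"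
  define I where "I = (\<lambda>x::real^'n ordered_index. \<chi> i. x $ inv ?h i)"
  have h: "bij ?h" by (rule bij_Rep_ordered_index)
  have hi: "inv ?h (?h x) = x" "?h (inv ?h y) = y" for x y
    using h by (simp_all add: bij_is_inj bij_is_surj surj_f_inv_f)
  have meas [measurable]: "P \<in> borel_measurable borel" "I \<in> borel_measurable borel"
    unfolding P_def I_def by (intro borel_measurable_continuous_onI continuous_intros)+
  have A_meas [measurable]: "(*v) A \<in> borel_measurable borel" "(*v) ?A \<in> borel_measurable borel"
    by (intro borel_measurable_continuous_onI linear_continuous_on matrix_vector_mul_bounded_linear)+
  have P: "distr lborel borel P = lborel"
    unfolding P_def by (rule lborel_distr_reindex[OF h])
  have I: "distr lborel borel I = lborel"
    unfolding I_def by (rule lborel_distr_reindex[OF bij_imp_bij_inv[OF h]])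
  have fac: "A *v x = I (?A *v P x)" for x
  proof -
    have "(\<Sum>j\<in>UNIV. A $ i $ j * x $ j) = (\<Sum>j\<in>UNIV. A $ i $ ?h j * x $ ?h j)" for i
      by (rule sum.reindex_bij_witness[where i = ?h and j = "inv ?h"]) (simp_all add: hi)
    then show ?thesis
      by (simp add: matrix_vector_mult_def P_def I_def vec_eq_iff hi)
  qed
  have det: "det ?A = det A" by (rule det_reindex[OF h])
  show "emeasure lborel S = emeasure (density (distr lborel borel ((*v) A)) (\<lambda>_. ennreal \<bar>det A\<bar>)) S"
    if "S \<in> sets lborel" for S
  proof -
    have S [measurable]: "S \<in> sets borel" using that by simp
    have "emeasure lborel S = emeasure lborel (I -` S)"
      by (subst I[symmetric]) (simp add: emeasure_distr)
    also have "\<dots> = ennreal \<bar>det A\<bar> * emeasure lborel ((*v) ?A -` (I -` S))"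
      using A measurable_sets_borel[OF meas(2) S]
      by (subst lborel_linear_wellorder[of ?A])
        (simp_all add: det emeasure_density_const emeasure_distr)
    also have "emeasure lborel ((*v) ?A -` (I -` S)) = emeasure lborel (P -` ((*v) ?A -` (I -` S)))"
      using measurable_sets_borel[OF A_meas(2) measurable_sets_borel[OF meas(2) S]]
      by (subst P[symmetric]) (simp add: emeasure_distr)
    also have "P -` ((*v) ?A -` (I -` S)) = (*v) A -` S"
      by (auto simp: fac)
    finally show ?thesis
      by (simp add: emeasure_density_const emeasure_distr)
  qed
qed simp

text \<open>Translation invariance removes \<open>t\<close>; the density supplies the determinant.
  For measurable \<open>g\<close>, integrability holds on both sides or on neither, and in the
  latter case both integrals are 0.\<close>

lemma lborel_integral_affine_image:
  fixes A :: "real ^ 'n ^ 'n::finite" and g :: "real ^ 'n \<Rightarrow> 'b::{banach, second_countable_topology}"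
  assumes A: "det A \<noteq> 0" and g [measurable]: "g \<in> borel_measurable borel"
  shows "(LINT x|lborel. g x) = \<bar>det A\<bar> *\<^sub>R (LINT x|lborel. g (A *v x + t))"
proof -
  have [measurable]: "(*v) A \<in> borel_measurable borel"
    by (intro borel_measurable_continuous_onI linear_continuous_on matrix_vector_mul_bounded_linear)
  have "(LINT x|lborel. g x) = (LINT x|distr lborel borel ((+) t). g x)"
    by (simp add: lborel_distr_plus)
  also have "\<dots> = (LINT x|lborel. g (t + x))"
    by (subst integral_distr) auto
  also have "\<dots> = \<bar>det A\<bar> *\<^sub>R (LINT x|lborel. g (A *v x + t))"
    by (subst lborel_linear[OF A]) (simp add: integral_density integral_distr add.commute)
  finally show ?thesis .
qed

section \<open>Minimal polynomials of algebraic units\<close>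

text \<open>The target field is generic because the same rational polynomial is evaluated at real
  and at complex numbers.\<close>

abbreviation peval :: "rat poly \<Rightarrow> 'a::field_char_0 \<Rightarrow> 'a" where
  "peval p z \<equiv> poly (map_poly of_rat p) z"

lemma peval_pCons: "peval (pCons a p) z = of_rat a + z * peval p z"
  by (simp add: map_poly_pCons)

lemma peval_add: "peval (p + q) z = peval p z + peval q z"
proof -
  have "map_poly of_rat (p + q) = map_poly of_rat p + (map_poly of_rat q :: 'a poly)"
    by (intro poly_eqI) (simp add: coeff_map_poly of_rat_add)
  then show ?thesis by simp
qed

lemma peval_smult: "peval (smult c p) z = of_rat c * peval p z"
  by (simp add: map_poly_smult of_rat_mult)

lemma peval_mult: "peval (p * q) z = peval p z * peval q z"
  by (induction p) (simp_all add: mult_pCons_left peval_add peval_smult peval_pCons algebra_simps)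

lemma peval_diff: "peval (p - q) z = peval p z - peval q z"
  using peval_add[of "p - q" q z] by simp

lemma peval_of_int_poly: "peval (map_poly of_int p) z = poly (map_poly of_int p) z"
  by (simp add: map_poly_map_poly o_def)

lemma irreducible_bezout:
  fixes m q :: "rat poly"
  assumes "irreducible m" "\<not> m dvd q"
  obtains u v where "u * m + v * q = 1"
proof -
  have "coprime m q"
    using assms by (intro prime_elem_imp_coprime) (simp_all add: prime_elem_iff_irreducible)
  moreover obtain u v where "bezout_coefficients m q = (u, v)"
    by fastforce
  ultimately show ?thesis
    using that bezout_coefficients[of m q u v] by simp
qed

text \<open>Otherwise a Bezout identity for \<open>m\<close> and \<open>q\<close>, evaluated at the
  common root \<open>z\<close>, would read 0 = 1.\<close>

lemma irreducible_root_dvd: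
  fixes z :: "'a::field_char_0"
  assumes "irreducible m" "peval m z = 0" "peval q z = 0"
  shows "m dvd q"
proof (rule ccontr)
  assume "\<not> m dvd q"
  then obtain u v where "u * m + v * q = 1"
    using irreducible_bezout assms(1) by blast
  then have "peval (u * m + v * q) z = 1" by simp
  then show False using assms by (simp add: peval_add peval_mult)
qed

text \<open>A nonzero polynomial of least degree vanishing at \<open>x\<close> is made monic. In any
  factorisation one factor vanishes at \<open>x\<close>, so it already has the full degree and the
  other factor is a unit.\<close>

lemma min_poly_exists:
  fixes x :: real
  assumes "algebraic_int x"
  shows "\<exists>m. lead_coeff m = 1 \<and> irreducible m \<and> peval m x = 0"
proof -
  let ?P = "\<lambda>p. p \<noteq> 0 \<and> peval p x = 0"
  obtain c where c: "poly (map_poly of_int c) x = 0" "lead_coeff c = (1::int)"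
    using assms algebraic_int_altdef_ipoly by blast
  have "?P (map_poly of_int c)"
    using c by (auto simp: peval_of_int_poly map_poly_eq_0_iff)
  then have "\<exists>p. ?P p \<and> (\<forall>q. ?P q \<longrightarrow> degree p \<le> degree q)"
    by (rule ex_has_least_nat)
  then obtain p where p: "?P p" and min: "\<And>q. ?P q \<Longrightarrow> degree p \<le> degree q"
    by blast
  define m where "m = smult (inverse (lead_coeff p)) p"
  have lc: "lead_coeff m = 1" and deg: "degree m = degree p" and root: "peval m x = 0"
    using p by (simp_all add: m_def peval_smult)
  have "irreducible m"
  proof (rule irreducibleI)
    show "m \<noteq> 0" using lc by auto
    show "\<not> is_unit m"
    proof
      assume "is_unit m"
      then obtain k where "m = [:k:]"
        by (auto simp: is_unit_poly_iff)
      then show False using root lc by (simp add: peval_pCons)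
    qed
    fix a b assume ab: "m = a * b"
    have unit: "is_unit b" if "m = a * b" "peval a x = 0" for a b
    proof -
      have nz: "a \<noteq> 0" "b \<noteq> 0" using that lc by auto
      then have "degree m = degree a + degree b"
        using that by (simp add: degree_mult_eq)
      moreover have "degree p \<le> degree a" using that nz min by blast
      ultimately show ?thesis
        using deg nz by (simp add: is_unit_iff_degree)
    qed
    have "peval a x = 0 \<or> peval b x = 0"
      using root ab by (simp add: peval_mult)
    then show "is_unit a \<or> is_unit b"
      using unit[of a b] unit[of b a] ab by (auto simp: mult.commute)
  qed
  then show ?thesis using lc root by blast
qed

text \<open>This discharges the definite description in \<open>min_poly\<close>: two candidates
  divide each other and are monic, hence equal.\<close>

lemma min_poly_props:
  assumes "algebraic_int x"
  shows "lead_coeff (min_poly x) = 1" "irreducible (min_poly x)" "peval (min_poly x) x = 0"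
proof -
  have "\<exists>!m. lead_coeff m = 1 \<and> irreducible m \<and> peval m x = 0"
  proof (rule ex_ex1I[OF min_poly_exists[OF assms]])
    fix m n :: "rat poly"
    assume m: "lead_coeff m = 1 \<and> irreducible m \<and> peval m x = 0"
      and n: "lead_coeff n = 1 \<and> irreducible n \<and> peval n x = 0"
    have "m dvd n" "n dvd m"
      using m n irreducible_root_dvd by blast+
    moreover have nz: "m \<noteq> 0" "n \<noteq> 0" using m n by auto
    ultimately have deg: "degree n = degree m"
      using dvd_imp_degree_le by (intro antisym) auto
    obtain k where k: "n = m * k" using \<open>m dvd n\<close> ..
    moreover have "m \<noteq> 0" "k \<noteq> 0" using k nz by auto
    ultimately have "degree k = 0" using deg by (simp add: degree_mult_eq)
    then obtain c where c: "k = [:c:]" by (rule degree_eq_zeroE)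
    then have "c = 1" using m n lead_coeff_mult[of m k] by (simp add: k)
    then show "m = n" using k c by simp
  qed
  from theI'[OF this, folded min_poly_def]
  show "lead_coeff (min_poly x) = 1" "irreducible (min_poly x)" "peval (min_poly x) x = 0"
    by auto
qed

section \<open>Primitive integer polynomials and Gauss's lemma\<close>

lemma rat_poly_primitive:
  fixes p :: "rat poly"
  assumes "p \<noteq> 0"
  obtains c a where "c \<noteq> 0" "content a = (1::int)" "p = smult c (map_poly of_int a)"
proof -
  \<comment> \<open>\<open>d\<close> is a common denominator of the coefficients, multiplied at each
    stage by the denominator \<open>v\<close> of the new coefficient.\<close>
  have "\<exists>d a. d \<noteq> 0 \<and> smult (of_int d) p = map_poly of_int (a :: int poly)"
  proof (induction p)
    case 0
    show ?case by (rule exI[of _ 1], rule exI[of _ 0]) simp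
  next
    case (pCons r p)
    then obtain d a where d: "d \<noteq> 0" "smult (of_int d) p = map_poly of_int a" by blast
    obtain u v where uv: "r = of_int u / of_int v" "v \<noteq> 0"
      by (metis Fract_of_int_quotient Rat_cases less_irrefl)
    have "smult (of_int (d * v)) p = smult (of_int v) (smult (of_int d) p)"
      by (simp add: mult.commute)
    then have "smult (of_int (d * v)) (pCons r p) = map_poly of_int (pCons (d * u) (smult v a))"
      unfolding d(2) using uv by (simp add: map_poly_pCons map_poly_smult)
    then show ?case using d uv by (metis mult_eq_0_iff)
  qed
  then obtain d a where d: "d \<noteq> 0" and eq: "smult (of_int d) p = map_poly of_int a" by blast
  have "a \<noteq> 0" using d eq assms by auto
  have "p = smult (inverse (of_int d)) (map_poly of_int a)"
    using d by (simp flip: eq)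
  also have "map_poly of_int a = smult (of_int (content a)) (map_poly rat_of_int (primitive_part a))"
    by (simp flip: map_poly_smult)
  finally have "p = smult (of_int (content a) / of_int d) (map_poly of_int (primitive_part a))"
    by (simp add: field_simps)
  moreover have "rat_of_int (content a) / of_int d \<noteq> 0" using \<open>a \<noteq> 0\<close> d by simp
  moreover have "content (primitive_part a) = 1" using \<open>a \<noteq> 0\<close> by simp
  ultimately show ?thesis using that by blast
qed

lemma map_poly_of_int_mult:
  "map_poly of_int (p * q) = map_poly of_int p * (map_poly of_int q :: 'a::comm_ring_1 poly)"
  by (intro poly_eqI) (simp add: coeff_map_poly coeff_mult)

lemma map_poly_of_int_inject:
  "map_poly of_int p = (map_poly of_int q :: 'a::{comm_ring_1,ring_char_0} poly) \<longleftrightarrow> p = q"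
  by (auto simp: poly_eq_iff coeff_map_poly)

text \<open>With the quotient written as \<open>u/v\<close> times a primitive \<open>b\<close>,
  clearing denominators gives \<open>v c = u a b\<close>. Contents are multiplicative and
  \<open>a b\<close> has content 1, so \<open>v\<close> divides \<open>u\<close> and the quotient is
  integral.\<close>

lemma gauss_primitive_dvd:
  fixes a c :: "int poly"
  assumes a: "content a = 1" and dvd: "map_poly rat_of_int a dvd map_poly of_int c"
  shows "a dvd c"
proof (cases "c = 0")
  case False
  obtain q where q: "map_poly of_int c = map_poly rat_of_int a * q"
    using dvd by (elim dvdE)
  have "q \<noteq> 0" using q False map_poly_of_int_inject[of c 0] by auto
  then obtain r b where r: "r \<noteq> 0" "content b = 1" "q = smult r (map_poly of_int b)"
    using rat_poly_primitive by blast
  obtain u v where uv: "r = of_int u / of_int v" "v \<noteq> 0"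
    by (metis Fract_of_int_quotient Rat_cases less_irrefl)
  have "smult (of_int v) (map_poly of_int c) = smult (of_int u) (map_poly rat_of_int (a * b))"
    unfolding q r(3) using uv by (simp add: map_poly_of_int_mult)
  then have eq: "smult v c = smult u (a * b)"
    by (simp add: map_poly_of_int_inject flip: map_poly_smult)
  then have "normalize v * content c = normalize u"
    using a r(2) by (metis content_mult content_smult mult.right_neutral)
  then have "v dvd u"
    using dvd_triv_left[of "normalize v" "content c"] by simp
  then obtain k where "u = v * k" ..
  then have "smult v (c - smult k (a * b)) = 0"
    using eq by (simp add: smult_diff_right)
  then have "c = a * smult k b"
    using uv(2) by simp
  then show ?thesis by (rule dvdI)
qed simp

text \<open>The primitive integer polynomial \<open>a\<close> proportional to \<open>m\<close>
  divides every integer polynomial vanishing at \<open>x\<close>. Dividing a monic one bounds its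
  leading coefficient to a sign; a polynomial for \<open>inverse x\<close> does the same for its
  constant coefficient. As \<open>m\<close> is monic, the scalar \<open>r\<close> is then a sign
  too.\<close>

lemma algebraic_unit_const_coeff:
  fixes x :: real
  assumes x: "algebraic_int x" "algebraic_int (inverse x)" "x \<noteq> 0"
    and m: "lead_coeff m = 1" "irreducible m" "peval m x = 0"
  shows "\<bar>coeff m 0\<bar> = 1"
proof -
  have "m \<noteq> 0" using m by auto
  then obtain r a where a: "r \<noteq> 0" "content a = 1" "m = smult r (map_poly of_int a)"
    using rat_poly_primitive by blast
  have adv: "a dvd c" if "poly (map_poly of_int c) x = 0" for c
  proof (rule gauss_primitive_dvd[OF a(2)])
    have "m dvd map_poly of_int c"
      using irreducible_root_dvd[OF m(2,3)] that by (simp add: peval_of_int_poly)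
    then show "map_poly of_int a dvd (map_poly of_int c :: rat poly)"
      using a by (simp add: smult_dvd_iff)
  qed
  obtain b where b: "poly (map_poly of_int b) x = 0" "lead_coeff b = (1::int)"
    using x algebraic_int_altdef_ipoly by blast
  obtain c where c: "poly (map_poly of_int c) (inverse x) = 0" "lead_coeff c = (1::int)"
    using x algebraic_int_altdef_ipoly by blast
  have "lead_coeff a dvd 1"
    using adv[OF b(1)] b(2) by (metis dvdE dvd_triv_left lead_coeff_mult)
  then have la: "\<bar>lead_coeff a\<bar> = 1" by simp
  \<comment> \<open>Reversing the coefficients turns the root \<open>inverse x\<close> into the root
    \<open>x\<close>, and the leading coefficient 1 of \<open>c\<close> into the constant
    coefficient.\<close>
  have "map_poly of_int (reflect_poly c) = reflect_poly (map_poly real_of_int c)"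
    by (intro poly_eqI) (simp add: coeff_reflect_poly coeff_map_poly degree_map_poly)
  then have "poly (map_poly of_int (reflect_poly c)) x = 0"
    using c(1) x(3) by (simp add: poly_reflect_poly_nz)
  then have "a dvd reflect_poly c" by (rule adv)
  then have "coeff a 0 dvd coeff (reflect_poly c) 0"
    by (metis coeff_mult_0 dvdE dvd_triv_left)
  then have a0: "\<bar>coeff a 0\<bar> = 1" using c(2) by simp
  have "r * of_int (lead_coeff a) = 1"
    using m(1) a(1,3) by (simp add: coeff_map_poly degree_map_poly)
  then have "\<bar>r\<bar> * of_int \<bar>lead_coeff a\<bar> = 1"
    by (metis abs_mult abs_one of_int_abs)
  then have "\<bar>r\<bar> = 1" using la by simp
  then show ?thesis using a0 a(3)
    by (simp add: coeff_map_poly abs_mult flip: of_int_abs)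
qed

text \<open>The derivative of \<open>m\<close> is nonzero of smaller degree, so \<open>m\<close>
  does not divide it, whereas a common root would force divisibility. Hence all roots are simple and
  a product over the set of roots suffices.\<close>

lemma irreducible_complex_roots:
  assumes m: "lead_coeff m = 1" "irreducible m"
  shows "map_poly of_rat m = (\<Prod>z | peval m z = 0. [:- z, 1 :: complex:])"
proof -
  have m0: "m \<noteq> 0" using m by auto
  have deg: "degree m \<noteq> 0"
    using m m0 by (metis irreducible_not_unit is_unit_iff_degree)
  then have pd: "pderiv m \<noteq> 0" "degree (pderiv m) < degree m"
    by (simp_all add: pderiv_eq_0_iff degree_pderiv)
  then have ndvd: "\<not> m dvd pderiv m"
    using dvd_imp_degree_le by fastforce
  have pde: "pderiv (map_poly of_rat m) = (map_poly of_rat (pderiv m) :: complex poly)"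
    by (intro poly_eqI) (simp add: coeff_map_poly coeff_pderiv of_rat_mult of_rat_add)
  have "rsquarefree (map_poly of_rat m :: complex poly)"
    unfolding rsquarefree_roots pde using irreducible_root_dvd[OF m(2)] ndvd by blast
  from complex_poly_decompose_rsquarefree[OF this] show ?thesis
    using m by (simp add: degree_map_poly coeff_map_poly)
qed

section \<open>Field embeddings and conjugates\<close>

text \<open>The inverse of a nonzero \<open>q(x)\<close> is a polynomial in \<open>x\<close>: it is
  the Bezout cofactor of \<open>q\<close> modulo \<open>m\<close>, evaluated at
  \<open>x\<close>.\<close>

lemma rat_adjoin_eq_range:
  assumes m: "irreducible m" "peval m x = 0"
  shows "rat_adjoin x = range (\<lambda>p. peval p x)"
proof
  show "range (\<lambda>p. peval p x) \<subseteq> rat_adjoin x"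
  proof
    fix y assume "y \<in> range (\<lambda>p. peval p x)"
    then obtain p where "y = peval p x / peval 1 x" by auto
    then show "y \<in> rat_adjoin x"
      unfolding rat_adjoin_def using map_poly_1[of "of_rat :: rat \<Rightarrow> real"] by fastforce
  qed
  show "rat_adjoin x \<subseteq> range (\<lambda>p. peval p x)"
  proof
    fix y assume "y \<in> rat_adjoin x"
    then obtain p q where y: "y = peval p x / peval q x" and q: "peval q x \<noteq> 0"
      by (auto simp: rat_adjoin_def)
    have "\<not> m dvd q"
      using q m(2) by (auto simp: peval_mult elim!: dvdE)
    then obtain u v where "u * m + v * q = 1"
      using irreducible_bezout m(1) by blast
    then have "peval (u * m + v * q) x = 1" by simp
    then have "peval v x * peval q x = 1"
      using m(2) by (simp add: peval_add peval_mult)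
    then have "y = peval (p * v) x"
      using q by (simp add: y peval_mult field_simps)
    then show "y \<in> range (\<lambda>p. peval p x)" by blast
  qed
qed

text \<open>The two laws force \<open>\<tau>\<close> to fix naturals, integers and fractions in
  turn, hence all coefficients. They are available only inside \<open>K\<close>, so intermediate
  values are first shown to lie there.\<close>

lemma field_embedding_peval:
  fixes \<tau> :: "real \<Rightarrow> 'a::field_char_0"
  assumes K: "K = range (\<lambda>p. peval p x)" and \<tau>: "\<tau> \<in> field_embeddings K"
  shows "\<tau> (peval p x) = peval p (\<tau> x)"
proof -
  have one: "\<tau> 1 = 1"
    and add: "\<And>y z. y \<in> K \<Longrightarrow> z \<in> K \<Longrightarrow> \<tau> (y + z) = \<tau> y + \<tau> z"
    and mult: "\<And>y z. y \<in> K \<Longrightarrow> z \<in> K \<Longrightarrow> \<tau> (y * z) = \<tau> y * \<tau> z"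
    using \<tau> by (auto simp: field_embeddings_def)
  have pK: "peval p x \<in> K" for p
    unfolding K by blast
  have rK: "of_rat r \<in> K" for r
    using pK[of "[:r:]"] by (simp add: peval_pCons)
  have nK: "of_nat n \<in> K" and iK: "of_int i \<in> K" for n i
    using rK[of "of_nat n"] rK[of "of_int i"] by simp_all
  have xK: "x \<in> K"
    using pK[of "[:0, 1:]"] by (simp add: peval_pCons)
  have zero: "\<tau> 0 = 0"
    using add[OF nK[of 0] nK[of 0]] by simp
  have nat: "\<tau> (of_nat n) = of_nat n" for n
  proof (induction n)
    case (Suc n)
    then show ?case using add[OF nK[of 1] nK[of n]] one by simp
  qed (simp add: zero)
  have int: "\<tau> (of_int i) = of_int i" for i
  proof (cases i rule: int_cases2)
    case (nonpos n)
    then show ?thesis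
      using add[OF iK[of i] nK[of n]] zero nat[of n] by (simp add: add_eq_0_iff2)
  qed (use nat in simp)
  have rat: "\<tau> (of_rat r) = of_rat r" for r
  proof -
    obtain u v where uv: "r = of_int u / of_int v" "v \<noteq> 0"
      by (metis Fract_of_int_quotient Rat_cases less_irrefl)
    have "\<tau> (of_rat r * of_int v) = \<tau> (of_int u)"
      using uv by (simp add: of_rat_divide)
    then have "\<tau> (of_rat r) * of_int v = of_int u"
      unfolding mult[OF rK iK] by (simp only: int)
    moreover have "of_rat r * of_int v = (of_int u :: 'a)"
      using uv by (simp add: of_rat_divide)
    ultimately show ?thesis
      using uv(2) by (metis mult_right_cancel of_int_eq_0_iff)
  qed
  show ?thesis
  proof (induction p)
    case (pCons a p)
    have "x * peval p x \<in> K"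
      using pK[of "pCons 0 p"] by (simp add: peval_pCons)
    then show ?case
      using pCons.IH by (simp add: peval_pCons add rK mult xK pK rat)
  qed (simp add: zero)
qed

text \<open>The image of the generator \<open>x\<close> determines an embedding and must be a root
  of \<open>m\<close>; conversely a root \<open>z\<close> yields the map sending \<open>p(x)\<close>
  to \<open>p(z)\<close>.\<close>

lemma field_embeddings_bij_roots:
  fixes x :: real
  assumes m: "irreducible m" "peval m x = 0"
  shows "bij_betw (\<lambda>\<tau>. \<tau> x) (field_embeddings (rat_adjoin x)) {z::'a::field_char_0. peval m z = 0}"
proof -
  define K where "K = rat_adjoin x"
  have K: "K = range (\<lambda>p. peval p x)"
    unfolding K_def by (rule rat_adjoin_eq_range[OF m])
  have ev: "\<tau> (peval p x) = peval p (\<tau> x)" if "\<tau> \<in> field_embeddings K" for \<tau> :: "real \<Rightarrow> 'a" and p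
    by (rule field_embedding_peval[OF K that])
  have "inj_on (\<lambda>\<tau>. \<tau> x) (field_embeddings K :: (real \<Rightarrow> 'a) set)"
  proof (rule inj_onI)
    fix \<tau> \<upsilon> :: "real \<Rightarrow> 'a"
    assume \<tau>: "\<tau> \<in> field_embeddings K" and \<upsilon>: "\<upsilon> \<in> field_embeddings K" and eq: "\<tau> x = \<upsilon> x"
    show "\<tau> = \<upsilon>"
    proof (rule extensionalityI[of _ K])
      show "\<tau> y = \<upsilon> y" if "y \<in> K" for y
        using that ev[OF \<tau>] ev[OF \<upsilon>] eq unfolding K by auto
    qed (use \<tau> \<upsilon> in \<open>simp_all add: field_embeddings_def\<close>)
  qed
  moreover have "(\<lambda>\<tau>. \<tau> x) ` field_embeddings K = {z::'a. peval m z = 0}"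
  proof (intro subset_antisym subsetI)
    fix z :: 'a assume "z \<in> (\<lambda>\<tau>. \<tau> x) ` field_embeddings K"
    then obtain \<tau> where \<tau>: "\<tau> \<in> field_embeddings K" and z: "z = \<tau> x" by blast
    have "\<tau> 0 = 0"
      using ev[OF \<tau>, of 0] by simp
    then show "z \<in> {z. peval m z = 0}"
      using ev[OF \<tau>, of m] m(2) z by simp
  next
    fix z :: 'a assume "z \<in> {z. peval m z = 0}"
    then have z: "peval m z = 0" by simp
    \<comment> \<open>The choice of representative is harmless: two polynomials with the same value
      at \<open>x\<close> differ by a multiple of \<open>m\<close>, which vanishes at
      \<open>z\<close>.\<close>
    define \<tau> where "\<tau> = restrict (\<lambda>y. peval (SOME p. peval p x = y) z) K"
    have \<tau>_ev: "\<tau> (peval p x) = peval p z" for p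
    proof -
      define q where "q = (SOME q. peval q x = peval p x)"
      have "peval q x = peval p x"
        unfolding q_def by (rule someI) (rule refl)
      then have "m dvd q - p"
        by (intro irreducible_root_dvd[OF m]) (simp add: peval_diff)
      then have "peval (q - p) z = 0"
        using z by (auto simp: peval_mult elim!: dvdE)
      then have "peval q z = peval p z" by (simp add: peval_diff)
      moreover have "\<tau> (peval p x) = peval q z"
        unfolding \<tau>_def q_def K by (simp add: restrict_apply)
      ultimately show ?thesis by simp
    qed
    have "\<tau> \<in> field_embeddings K"
      unfolding field_embeddings_def
    proof (intro CollectI conjI ballI)
      show "\<tau> \<in> extensional K" by (simp add: \<tau>_def)
      show "\<tau> 1 = 1" using \<tau>_ev[of 1] by simp
      fix y y' assume "y \<in> K" "y' \<in> K"
      then obtain p q where "y = peval p x" "y' = peval q x" unfolding K by blast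
      then show "\<tau> (y + y') = \<tau> y + \<tau> y'" "\<tau> (y * y') = \<tau> y * \<tau> y'"
        using \<tau>_ev[of "p + q"] \<tau>_ev[of "p * q"] by (simp_all add: peval_add peval_mult \<tau>_ev)
    qed
    moreover have "\<tau> x = z"
      using \<tau>_ev[of "[:0, 1:]"] by (simp add: peval_pCons)
    ultimately show "z \<in> (\<lambda>\<tau>. \<tau> x) ` field_embeddings K" by blast
  qed
  ultimately show ?thesis by (simp add: bij_betw_def K_def)
qed

text \<open>Coefficients are rational, so an embedding maps all of \<open>K\<close> into the reals
  exactly when it does so with \<open>x\<close>.\<close>

lemma nonreal_embeddings_bij_roots:
  fixes x :: real
  assumes m: "irreducible m" "peval m x = 0"
  shows "bij_betw (\<lambda>\<tau>. \<tau> x) (nonreal_embeddings (rat_adjoin x)) {z. peval m z = 0 \<and> z \<notin> \<real>}"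
proof -
  define K where "K = rat_adjoin x"
  have K: "K = range (\<lambda>p. peval p x)"
    unfolding K_def by (rule rat_adjoin_eq_range[OF m])
  have "x \<in> K"
    unfolding K by (rule range_eqI[of _ _ "[:0, 1:]"]) (simp add: peval_pCons)
  have rat_real: "of_rat r \<in> (\<real> :: complex set)" for r
    by (cases r) (simp add: of_rat_rat)
  have real: "peval p z \<in> \<real>" if "z \<in> \<real>" for p and z :: complex
    using that by (induction p) (auto simp: peval_pCons rat_real intro!: Reals_add Reals_mult)
  have *: "\<tau> ` K \<subseteq> \<real> \<longleftrightarrow> \<tau> x \<in> \<real>" if "\<tau> \<in> field_embeddings K" for \<tau> :: "real \<Rightarrow> complex"
    using \<open>x \<in> K\<close> real field_embedding_peval[OF K that] unfolding K by auto
  have eq: "nonreal_embeddings K = {\<tau> \<in> field_embeddings K. \<tau> x \<notin> \<real>}"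
    unfolding nonreal_embeddings_def using * by blast
  have "bij_betw (\<lambda>\<tau>. \<tau> x) (field_embeddings K) {z::complex. peval m z = 0}"
    unfolding K_def by (rule field_embeddings_bij_roots[OF m])
  then have inj: "inj_on (\<lambda>\<tau>. \<tau> x) (field_embeddings K :: (real \<Rightarrow> complex) set)"
    and img: "(\<lambda>\<tau>. \<tau> x) ` field_embeddings K = {z::complex. peval m z = 0}"
    by (simp_all add: bij_betw_def)
  have "(\<lambda>\<tau>. \<tau> x) ` nonreal_embeddings K = (\<lambda>\<tau>. \<tau> x) ` field_embeddings K - \<real>"
    unfolding eq by blast
  then have "(\<lambda>\<tau>. \<tau> x) ` nonreal_embeddings K = {z. peval m z = 0 \<and> z \<notin> \<real>}"
    unfolding img by blast
  moreover have "inj_on (\<lambda>\<tau>. \<tau> x) (nonreal_embeddings K)"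
    using inj by (rule inj_on_subset) (simp add: eq)
  ultimately show ?thesis
    unfolding K_def[symmetric] bij_betw_def by simp
qed

text \<open>The second claim is the absolute norm of a unit, read off at 0 from the factorisation
  over the complex roots. Each \<open>\<sigma> k\<close> accounts for a root and its complex
  conjugate, hence the square; the factor of \<open>\<kappa> 1\<close> is kept apart because
  internal space omits it.\<close>

lemma embedding_list_conjugates:
  fixes x :: real
  assumes x: "algebraic_int x" "algebraic_int (inverse x)" "x \<noteq> 0"
    and l: "embedding_list (rat_adjoin x) r \<kappa> s \<sigma>"
  shows "degree (min_poly x) = r + 2 * s"
    and "\<bar>x\<bar> * (\<Prod>i\<in>{2..r}. \<bar>\<kappa> i x\<bar>) * (\<Prod>k\<in>{1..s}. (cmod (\<sigma> k x))\<^sup>2) = 1"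
proof -
  define m where "m = min_poly x"
  note m = min_poly_props[OF x(1), folded m_def]
  define K where "K = rat_adjoin x"
  have "x \<in> K"
    unfolding K_def rat_adjoin_eq_range[OF m(2,3)]
    by (rule range_eqI[of _ _ "[:0, 1:]"]) (simp add: peval_pCons)
  define Z where "Z = {z::complex. peval m z = 0}"
  define \<phi> where "\<phi> = (\<lambda>(i, c). if c then cnj (\<sigma> i x) else \<sigma> i x)"
  have l': "bij_betw \<kappa> {1..r} (field_embeddings K)" "1 \<le> r" "\<kappa> 1 = restrict id K"
    "bij_betw (\<lambda>(i, conj). if conj then restrict (cnj \<circ> \<sigma> i) K else \<sigma> i)
       ({1..s} \<times> {False, True}) (nonreal_embeddings K)"
    using l unfolding embedding_list_def real_embeddings_def K_def[symmetric] by blast+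
  have bR: "bij_betw (\<lambda>i. \<kappa> i x) {1..r} {y::real. peval m y = 0}"
    using bij_betw_trans[OF l'(1)[unfolded K_def] field_embeddings_bij_roots[OF m(2,3)]]
    by (simp add: o_def)
  have "bij_betw ((\<lambda>\<tau>. \<tau> x) \<circ> (\<lambda>(i, conj). if conj then restrict (cnj \<circ> \<sigma> i) K else \<sigma> i))
      ({1..s} \<times> {False, True}) {z. peval m z = 0 \<and> z \<notin> \<real>}"
    by (rule bij_betw_trans[OF l'(4) nonreal_embeddings_bij_roots[OF m(2,3), folded K_def]])
  moreover have "(\<lambda>\<tau>. \<tau> x) \<circ> (\<lambda>(i, conj). if conj then restrict (cnj \<circ> \<sigma> i) K else \<sigma> i) = \<phi>"
    using \<open>x \<in> K\<close> by (auto simp: \<phi>_def fun_eq_iff)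
  ultimately have bC: "bij_betw \<phi> ({1..s} \<times> {False, True}) {z. peval m z = 0 \<and> z \<notin> \<real>}"
    by simp
  have ofr: "peval m (complex_of_real y) = of_real (peval m y)" for y
  proof -
    have "complex_of_real (of_rat q) = of_rat q" for q
      by (cases q) (simp add: of_rat_rat)
    then show ?thesis
      by (simp add: poly_altdef degree_map_poly coeff_map_poly)
  qed
  have "bij_betw complex_of_real {y::real. peval m y = 0} {z. peval m z = 0 \<and> z \<in> \<real>}"
    by (auto simp: bij_betw_def inj_on_def ofr elim!: Reals_cases)
  from bij_betw_trans[OF bR this]
  have bR': "bij_betw (\<lambda>i. complex_of_real (\<kappa> i x)) {1..r} {z. peval m z = 0 \<and> z \<in> \<real>}"
    by (simp add: o_def)
  have finR: "finite {z::complex. peval m z = 0 \<and> z \<in> \<real>}" "finite {z::complex. peval m z = 0 \<and> z \<notin> \<real>}"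
    using bij_betw_finite[OF bR'] bij_betw_finite[OF bC] by simp_all
  have Zun: "Z = {z. peval m z = 0 \<and> z \<in> \<real>} \<union> {z. peval m z = 0 \<and> z \<notin> \<real>}"
    by (auto simp: Z_def)
  have prod: "(\<Prod>z\<in>Z. g z) = (\<Prod>i\<in>{1..r}. g (of_real (\<kappa> i x))) * (\<Prod>k\<in>{1..s}. g (\<sigma> k x) * g (cnj (\<sigma> k x)))"
    for g :: "complex \<Rightarrow> 'c::comm_monoid_mult"
  proof -
    have "(\<Prod>z\<in>Z. g z) = (\<Prod>z\<in>{z. peval m z = 0 \<and> z \<in> \<real>}. g z) * (\<Prod>z\<in>{z. peval m z = 0 \<and> z \<notin> \<real>}. g z)"
      unfolding Zun by (intro prod.union_disjoint finR) auto
    also have "(\<Prod>z\<in>{z. peval m z = 0 \<and> z \<in> \<real>}. g z) = (\<Prod>i\<in>{1..r}. g (of_real (\<kappa> i x)))"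
      by (rule prod.reindex_bij_betw[OF bR', symmetric])
    also have "(\<Prod>z\<in>{z. peval m z = 0 \<and> z \<notin> \<real>}. g z) = (\<Prod>p\<in>{1..s} \<times> {False, True}. g (\<phi> p))"
      by (rule prod.reindex_bij_betw[OF bC, symmetric])
    also have "\<dots> = (\<Prod>k\<in>{1..s}. \<Prod>c\<in>{False, True}. g (\<phi> (k, c)))"
      by (subst prod.cartesian_product) (simp add: case_prod_beta)
    also have "\<dots> = (\<Prod>k\<in>{1..s}. g (\<sigma> k x) * g (cnj (\<sigma> k x)))"
      by (simp add: \<phi>_def)
    finally show ?thesis .
  qed
  have decomp: "map_poly of_rat m = (\<Prod>z\<in>Z. [:- z, 1 :: complex:])"
    unfolding Z_def by (rule irreducible_complex_roots[OF m(1,2)])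
  have "card Z = r + card ({1..s} \<times> {False, True})"
    unfolding Zun using bij_betw_same_card[OF bR'] bij_betw_same_card[OF bC] finR
    by (subst card_Un_disjoint) auto
  then have "card Z = r + 2 * s" by (simp add: card_cartesian_product)
  moreover have "degree (map_poly of_rat m :: complex poly) = card Z"
    unfolding decomp by (subst degree_prod_sum_eq) auto
  ultimately show "degree (min_poly x) = r + 2 * s"
    by (simp add: degree_map_poly m_def)
  have "poly (map_poly of_rat m) 0 = (\<Prod>z\<in>Z. - z :: complex)"
    unfolding decomp by (simp add: poly_prod)
  then have "cmod (of_rat (coeff m 0)) = (\<Prod>z\<in>Z. cmod z)"
    by (simp add: poly_0_coeff_0 coeff_map_poly flip: prod_norm)
  moreover have "cmod (of_rat (coeff m 0)) = 1"
    using algebraic_unit_const_coeff[OF x m] by (auto simp: abs_if split: if_splits simp flip: of_rat_minus) 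
  ultimately have "1 = (\<Prod>i\<in>{1..r}. \<bar>\<kappa> i x\<bar>) * (\<Prod>k\<in>{1..s}. (cmod (\<sigma> k x))\<^sup>2)"
    by (simp add: prod power2_eq_square)
  also have "{1..r} = insert 1 {2..r}" using l'(2) by auto
  also have "(\<Prod>i\<in>insert 1 {2..r}. \<bar>\<kappa> i x\<bar>) = \<bar>x\<bar> * (\<Prod>i\<in>{2..r}. \<bar>\<kappa> i x\<bar>)"
    using l'(3) \<open>x \<in> K\<close> by simp
  finally show "\<bar>x\<bar> * (\<Prod>i\<in>{2..r}. \<bar>\<kappa> i x\<bar>) * (\<Prod>k\<in>{1..s}. (cmod (\<sigma> k x))\<^sup>2) = 1"
    by simp
qed

section \<open>The determinant of the contraction on internal space\<close>

text \<open>The positions \<open>r + 2k - 2\<close> and \<open>r + 2k - 1\<close> both belong to the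
  complex pair number \<open>k\<close>, hence the square.\<close>

lemma prod_pairs:
  fixes g :: "nat \<Rightarrow> 'a::comm_semiring_1"
  shows "(\<Prod>n\<in>{r..<r + 2 * s}. g ((n - r) div 2 + 1)) = (\<Prod>k\<in>{1..s}. (g k)\<^sup>2)"
proof (induction s)
  case (Suc s)
  have "{r..<r + 2 * Suc s} = insert (r + 2 * s + 1) (insert (r + 2 * s) {r..<r + 2 * s})"
    by auto
  then show ?case
    using Suc by (simp add: power2_eq_square mult_ac)
qed simp

text \<open>The blocks of the matrix are scaled rotations, so \<open>Q Q\<^sup>T\<close> is diagonal; this gives the
  determinant up to sign.\<close>

lemma star_matrix_mult_transpose:
  fixes e :: "'m::finite \<Rightarrow> nat"
  assumes r: "1 \<le> r" and e: "bij_betw e UNIV {1..<r + 2 * s}"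
  shows "star_matrix e r \<kappa> \<sigma> x ** transpose (star_matrix e r \<kappa> \<sigma> x) =
    (\<chi> a b. if a = b then
       if e a < r then (\<kappa> (e a + 1) x)\<^sup>2 else (cmod (\<sigma> ((e a - r) div 2 + 1) x))\<^sup>2 else 0)"
proof -
  \<comment> \<open>These are the matrix entries by numerical position, so that sums over the index
    type become sums over an interval of naturals.\<close>
  define q where "q i j = (if i < r \<or> j < r then (if i = j then \<kappa> (i + 1) x else 0)
      else let k = i - r; l = j - r; z = \<sigma> (k div 2 + 1) x in
       if k div 2 \<noteq> l div 2 then 0
       else if k = l then Re z
       else if even k then - Im z
       else Im z)" for i j :: nat
  define D where "D i = (if i < r then (\<kappa> (i + 1) x)\<^sup>2 else (cmod (\<sigma> ((i - r) div 2 + 1) x))\<^sup>2)" for i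
  have inj: "e a = e b \<longleftrightarrow> a = b" for a b
    using e by (auto simp: bij_betw_def inj_on_def)
  have Q: "star_matrix e r \<kappa> \<sigma> x $ a $ b = q (e a) (e b)" for a b
    unfolding star_matrix_def q_def by (simp add: inj)
  have range: "e a \<in> {1..<r + 2 * s}" for a
    using e by (auto simp: bij_betw_def)
  have main: "(\<Sum>n\<in>{1..<r + 2 * s}. q i n * q j n) = (if i = j then D i else 0)"
    if i: "i \<in> {1..<r + 2 * s}" for i j
  proof (cases "i < r")
    case True
    have "(\<Sum>n\<in>{1..<r + 2 * s}. q i n * q j n) = (\<Sum>n\<in>{i}. q i n * q j n)"
      using i True by (intro sum.mono_neutral_right) (auto simp: q_def)
    then show ?thesis
      using True by (auto simp: q_def D_def power2_eq_square)
  next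
    case False
    define k where "k = i - r"
    have ik: "i = r + k" using False by (simp add: k_def)
    \<comment> \<open>\<open>k'\<close> is the other member of the pair containing \<open>k\<close>;
      apart from the diagonal, row \<open>i\<close> can be nonzero only in that column.\<close>
    define k' where "k' = (if even k then k + 1 else k - 1)"
    have k': "k' \<noteq> k" "k' div 2 = k div 2" "even k' \<longleftrightarrow> odd k" "k' < 2 * s"
      and only: "\<And>l. l div 2 = k div 2 \<Longrightarrow> l = k \<or> l = k'"
    proof -
      have "k < 2 * s" using i ik by simp
      then show "k' \<noteq> k" "k' div 2 = k div 2" "even k' \<longleftrightarrow> odd k" "k' < 2 * s"
        unfolding k'_def by presburger+
      show "l = k \<or> l = k'" if "l div 2 = k div 2" for l
        using that unfolding k'_def by presburger
    qed
    have zero: "q i n = 0" if "n \<noteq> i" "n \<noteq> r + k'" for n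
      using that only[of "n - r"] by (auto simp: q_def ik Let_def)
    have "(\<Sum>n\<in>{1..<r + 2 * s}. q i n * q j n) = (\<Sum>n\<in>{i, r + k'}. q i n * q j n)"
      using i k'(4) r zero by (intro sum.mono_neutral_right) auto
    also have "\<dots> = q i i * q j i + q i (r + k') * q j (r + k')"
      using k'(1) ik by simp
    also have "\<dots> = (if i = j then D i else 0)"
    proof -
      have qi: "q i i = Re (\<sigma> (k div 2 + 1) x)"
        "q i (r + k') = (if even k then - Im (\<sigma> (k div 2 + 1) x) else Im (\<sigma> (k div 2 + 1) x))"
        "q (r + k') i = (if even k then Im (\<sigma> (k div 2 + 1) x) else - Im (\<sigma> (k div 2 + 1) x))"
        "q (r + k') (r + k') = Re (\<sigma> (k div 2 + 1) x)"
        using k' by (simp_all add: q_def ik)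
      \<comment> \<open>A row with itself gives the squared modulus; with its partner, the two mixed
        products of real and imaginary part cancel; all other rows have disjoint support.\<close>
      consider "j = i" | "j = r + k'" | "j \<noteq> i" "j \<noteq> r + k'" by blast
      then show ?thesis
      proof cases
        case 1
        then show ?thesis
          using qi by (simp add: D_def ik cmod_power2 flip: power2_eq_square)
      next
        case 2
        then show ?thesis
          using qi k'(1) ik by simp
      next
        case 3
        then have "q j i = 0" "q j (r + k') = 0"
          using only[of "j - r"] k'(2) by (auto simp: q_def ik Let_def)
        then show ?thesis using 3 by simp
      qed
    qed
    finally show ?thesis .
  qed
  have "(\<Sum>c\<in>UNIV. q (e a) (e c) * q (e b) (e c)) = (if a = b then D (e a) else 0)" for a b
    using main[OF range, of a "e b"]
    by (simp add: inj sum.reindex_bij_betw[OF e, of "\<lambda>n. q (e a) n * q (e b) n"])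
  then show ?thesis
    by (simp add: vec_eq_iff matrix_matrix_mult_def transpose_def Q D_def)
qed

text \<open>In the diagonal of \<open>Q Q^T\<close> real conjugates occur squared and each squared
  complex modulus occurs twice. The nonnegative square root is the product of all conjugates other
  than \<open>x\<close>, in modulus.\<close>

lemma abs_det_star_matrix:
  fixes e :: "'m::finite \<Rightarrow> nat"
  assumes x: "x > 0" "algebraic_int x" "algebraic_int (inverse x)"
    and l: "embedding_list (rat_adjoin x) r \<kappa> s \<sigma>"
    and e: "bij_betw e UNIV {1..degree (min_poly x) - 1}"
  shows "\<bar>det (star_matrix e r \<kappa> \<sigma> x)\<bar> = inverse x"
proof -
  let ?Q = "star_matrix e r \<kappa> \<sigma> x"
  define p1 where "p1 = (\<Prod>i\<in>{2..r}. \<bar>\<kappa> i x\<bar>)"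
  define p2 where "p2 = (\<Prod>k\<in>{1..s}. (cmod (\<sigma> k x))\<^sup>2)"
  define D where "D i = (if i < r then (\<kappa> (i + 1) x)\<^sup>2 else (cmod (\<sigma> ((i - r) div 2 + 1) x))\<^sup>2)" for i
  have r: "1 \<le> r" using l by (simp add: embedding_list_def)
  have deg: "degree (min_poly x) = r + 2 * s" and norm: "x * p1 * p2 = 1"
    using embedding_list_conjugates[OF x(2,3) _ l] x(1) by (simp_all add: p1_def p2_def)
  have e': "bij_betw e UNIV {1..<r + 2 * s}"
    using e r unfolding deg by (simp add: atLeastLessThanSuc_atLeastAtMost[symmetric])
  have "(det ?Q)\<^sup>2 = det (?Q ** transpose ?Q)"
    by (simp add: det_mul power2_eq_square)
  also have "\<dots> = (\<Prod>a\<in>UNIV. D (e a))"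
    unfolding star_matrix_mult_transpose[OF r e'] by (subst det_diagonal) (simp_all add: D_def)
  also have "\<dots> = (\<Prod>n\<in>{1..<r + 2 * s}. D n)"
    by (rule prod.reindex_bij_betw[OF e'])
  also have "\<dots> = (\<Prod>n\<in>{1..<r}. D n) * (\<Prod>n\<in>{r..<r + 2 * s}. D n)"
    using r by (simp add: prod.atLeastLessThan_concat)
  also have "(\<Prod>n\<in>{r..<r + 2 * s}. D n) = p2\<^sup>2"
    using prod_pairs[of "\<lambda>k. (cmod (\<sigma> k x))\<^sup>2" r s]
    by (simp add: D_def p2_def prod_power_distrib)
  also have "(\<Prod>n\<in>{1..<r}. D n) = (\<Prod>n\<in>{1..<r}. \<bar>\<kappa> (n + 1) x\<bar>\<^sup>2)"
    by (simp add: D_def)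
  \<comment> \<open>Coordinate \<open>n\<close> belongs to \<open>\<kappa> (n + 1)\<close>, so the
    range \<open>{1..<r}\<close> becomes \<open>{2..r}\<close>.\<close>
  also have "\<dots> = p1\<^sup>2"
    unfolding p1_def prod_power_distrib[symmetric]
    by (intro arg_cong[where f = "\<lambda>t. t\<^sup>2"]
        prod.reindex_bij_witness[of _ "\<lambda>n. n - 1" "\<lambda>n. n + 1"]) auto
  finally have "\<bar>det ?Q\<bar>\<^sup>2 = (p1 * p2)\<^sup>2" by (simp add: power_mult_distrib)
  moreover have "0 \<le> p1 * p2"
    unfolding p1_def p2_def by (intro mult_nonneg_nonneg prod_nonneg) auto
  ultimately have "\<bar>det ?Q\<bar> = p1 * p2"
    by (metis abs_ge_zero power2_eq_iff_nonneg)
  also have "\<dots> = inverse x"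
    using norm x(1) by (simp add: field_simps)
  finally show ?thesis .
qed

section \<open>Windows and their Fourier transforms\<close>

lemma integrable_character_indicator:
  fixes S :: "(real ^ 'm) set"
  assumes "compact S"
  shows "integrable lborel (\<lambda>x. exp (2 * pi * \<i> * complex_of_real (x \<bullet> y)) * indicator S x)"
proof -
  have "integrable lborel (\<lambda>x. indicator S x *\<^sub>R exp (2 * pi * \<i> * complex_of_real (x \<bullet> y)))"
    using assms by (intro borel_integrable_compact continuous_intros)
  then show ?thesis
    by (rule Bochner_Integration.integrable_cong[THEN iffD1, rotated -1]) (auto simp: indicator_def)
qed

lemma integrable_indicator_compact:
  fixes S :: "'a::euclidean_space set"
  assumes "compact S"
  shows "integrable lborel (indicator S :: 'a \<Rightarrow> real)"
  using assms borel_integrable_compact[of S "\<lambda>_. 1::real"] by simp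

section \<open>Affine images of compact sets: volume and Fourier transform\<close>

lemma compact_affine_image:
  fixes A :: "real ^ 'm ^ 'm"
  assumes "compact S"
  shows "compact ((\<lambda>z. A *v z + t) ` S)"
  using assms
  by (intro compact_continuous_image continuous_on_add continuous_on_const
      linear_continuous_on matrix_vector_mul_bounded_linear)

lemma inj_affine:
  fixes A :: "real ^ 'm ^ 'm"
  assumes "det A \<noteq> 0"
  shows "inj (\<lambda>z. A *v z + t)"
proof -
  have "invertible A"
    using assms by (simp add: invertible_det_nz)
  then have "inj ((*v) A)"
    by (simp only: invertible_left_inverse matrix_left_invertible_injective)
  then show ?thesis by (auto simp: inj_def)
qed

lemma measure_affine_image:
  fixes A :: "real ^ 'm ^ 'm"
  assumes A: "det A \<noteq> 0" and S: "compact S"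
  shows "measure lborel ((\<lambda>z. A *v z + t) ` S) = \<bar>det A\<bar> * measure lborel S"
proof -
  let ?g = "\<lambda>z. A *v z + t"
  have [measurable]: "?g ` S \<in> sets borel" "S \<in> sets borel"
    using S compact_affine_image by (auto intro: borel_compact)
  have "measure lborel (?g ` S) = (LINT x|lborel. indicator (?g ` S) x)"
    by simp
  also have "\<dots> = \<bar>det A\<bar> * (LINT x|lborel. indicator (?g ` S) (?g x))"
    by (subst lborel_integral_affine_image[OF A, where t = t]) simp_all
  also have "(\<lambda>x. indicator (?g ` S) (?g x) :: real) = indicator S"
    by (simp add: indicator_def fun_eq_iff inj_image_mem_iff[OF inj_affine[OF A]])
  finally show ?thesis by simp
qed

text \<open>After substitution the phase splits: the translation \<open>t\<close> leaves the
  integral as a character, and \<open>A\<close> moves to the frequency as its transpose. This is the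
  origin of the entries of \<open>B\<close> and of \<open>R\<close>.\<close>

lemma inverse_fourier_affine_image:
  fixes A :: "real ^ 'm ^ 'm"
  assumes A: "det A \<noteq> 0" and S: "compact S"
  shows "inverse_fourier (indicator ((\<lambda>z. A *v z + t) ` S)) y =
    complex_of_real \<bar>det A\<bar> * (exp (2 * pi * \<i> * complex_of_real (t \<bullet> y)) *
      inverse_fourier (indicator S) (transpose A *v y))"
proof -
  let ?g = "\<lambda>z. A *v z + t"
  let ?e = "\<lambda>x y. exp (2 * pi * \<i> * complex_of_real (x \<bullet> y))"
  have [measurable]: "?g ` S \<in> sets borel"
    using compact_affine_image[OF S] by (rule borel_compact)
  have [measurable]: "(\<lambda>x. ?e x y) \<in> borel_measurable borel"
    by (intro borel_measurable_continuous_onI continuous_intros)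
  have ind: "indicator (?g ` S) (?g x) = (indicator S x :: complex)" for x
    by (simp add: indicator_def inj_image_mem_iff[OF inj_affine[OF A]])
  have dot: "?g x \<bullet> y = t \<bullet> y + x \<bullet> (transpose A *v y)" for x
    using dot_lmul_matrix[of y A x]
    by (simp add: inner_add_left inner_add_right inner_commute)
  have "inverse_fourier (indicator (?g ` S)) y
      = \<bar>det A\<bar> *\<^sub>R (LINT x|lborel. ?e (?g x) y * indicator (?g ` S) (?g x))"
    unfolding inverse_fourier_def by (rule lborel_integral_affine_image[OF A]) simp
  also have "(\<lambda>x. ?e (?g x) y * indicator (?g ` S) (?g x))
      = (\<lambda>x. ?e t y * (?e x (transpose A *v y) * indicator S x))"
    unfolding ind dot by (simp add: exp_add ring_distribs fun_eq_iff)
  finally show ?thesis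
    unfolding inverse_fourier_def by (simp add: scaleR_conv_of_real)
qed

text \<open>Dominated convergence along sequences of frequencies; characters have modulus 1, so the
  indicator of the compact set is a majorant.\<close>

lemma continuous_on_inverse_fourier_indicator:
  fixes S :: "(real ^ 'm) set"
  assumes S: "compact S"
  shows "continuous_on UNIV (inverse_fourier (indicator S))"
  unfolding continuous_on_sequentially
proof (intro allI ballI impI)
  fix Y and y :: "real ^ 'm"
  assume "(\<forall>n. Y n \<in> UNIV) \<and> Y \<longlonglongrightarrow> y"
  then have lim: "Y \<longlonglongrightarrow> y" by simp
  let ?e = "\<lambda>x y. exp (2 * pi * \<i> * complex_of_real (x \<bullet> y))"
  have [measurable]: "S \<in> sets borel" using S by (rule borel_compact)
  have [measurable]: "(\<lambda>x. ?e x y) \<in> borel_measurable borel" for y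
    by (intro borel_measurable_continuous_onI continuous_intros)
  have int: "integrable lborel (indicator S :: real ^ 'm \<Rightarrow> real)"
    by (rule integrable_indicator_compact[OF S])
  have "(\<lambda>n. LINT x|lborel. ?e x (Y n) * indicator S x) \<longlonglongrightarrow> (LINT x|lborel. ?e x y * indicator S x)"
  proof (rule integral_dominated_convergence[OF _ _ int])
    show "AE x in lborel. (\<lambda>n. ?e x (Y n) * indicator S x) \<longlonglongrightarrow> ?e x y * indicator S x"
      using lim by (intro AE_I2 tendsto_intros)
    show "AE x in lborel. norm (?e x (Y n) * indicator S x) \<le> indicator S x" for n
      by (intro AE_I2) (simp add: norm_mult norm_exp_eq_Re indicator_def)
  qed simp_all
  then show "(inverse_fourier (indicator S) \<circ> Y) \<longlonglongrightarrow> inverse_fourier (indicator S) y"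
    by (simp add: inverse_fourier_def o_def)
qed

text \<open>Positions are the image of the places where \<open>i\<close> occurs in
  \<open>\<rho> j\<close>. The volume estimate uses the count in this direction.\<close>

lemma card_tile_positions_le:
  "finite (tile_positions \<rho> len i j)" "card (tile_positions \<rho> len i j) \<le> count_list (\<rho> j) i"
proof -
  let ?I = "{k. k < length (\<rho> j) \<and> \<rho> j ! k = i}"
  have eq: "tile_positions \<rho> len i j = (\<lambda>k. sum_list (map (($) len) (take k (\<rho> j)))) ` ?I"
    by (auto simp: tile_positions_def)
  have fin: "finite ?I" by simp
  show "finite (tile_positions \<rho> len i j)"
    unfolding eq by (intro finite_imageI fin)
  have "card ?I = count_list (\<rho> j) i"
    by (simp add: count_list_eq_length_filter length_filter_conv_card eq_commute)
  then show "card (tile_positions \<rho> len i j) \<le> count_list (\<rho> j) i"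
    unfolding eq using card_image_le[OF fin] by metis
qed

text \<open>Pairing the volumes of the windows with the left eigenvector shows that none of the unions
  loses volume.\<close>

lemma window_system_AE_disjoint:
  fixes W :: "'n::finite \<Rightarrow> (real ^ 'm) set" and Q :: "real ^ 'm ^ 'm" and M :: "real ^ 'n ^ 'n"
  assumes lam: "lam > 0" and det: "\<bar>det Q\<bar> = inverse lam"
    and fin: "\<And>i j. finite (T i j)" and card: "\<And>i j. real (card (T i j)) \<le> M $ i $ j"
    and eig: "u v* M = lam *s u" and pos: "\<And>i. u $ i > 0"
    and W: "window_system Q (\<lambda>i j. star ` T i j) W"
  shows "AE x in lborel. (indicator (W i) x :: real) =
    (\<Sum>j\<in>UNIV. \<Sum>t\<in>T i j. indicator ((\<lambda>z. Q *v z + star t) ` W j) x)"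
proof -
  define g where "g t z = Q *v z + star t" for t z
  \<comment> \<open>\<open>h i x\<close> counts the pieces of \<open>W i\<close> containing
    \<open>x\<close>, once for every \<open>t\<close>, even if two positions share a star image. Any
    excess over the indicator is an overlap.\<close>
  define h where "h i x = (\<Sum>j\<in>UNIV. \<Sum>t\<in>T i j. indicator (g t ` W j) x :: real)" for i x
  define \<mu> where "\<mu> j = measure lborel (W j)" for j
  have det0: "det Q \<noteq> 0" using det lam by auto
  have cW: "compact (W j)" for j using W unfolding window_system_def by blast
  have cgW: "compact (g t ` W j)" for t j
    unfolding g_def by (rule compact_affine_image[OF cW])
  have Wi: "W i = (\<Union>j. \<Union>t\<in>T i j. g t ` W j)" for i
  proof -
    have "(\<Union>v\<in>star ` T i j. (\<lambda>x. Q *v x + v) ` W j) = (\<Union>t\<in>T i j. g t ` W j)" for j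
      by (simp add: g_def)
    moreover have "W i = (\<Union>j. \<Union>v\<in>star ` T i j. (\<lambda>x. Q *v x + v) ` W j)"
      using W unfolding window_system_def by (elim conjE) (rule spec)
    ultimately show ?thesis by (simp only:)
  qed
  have ind_int: "integrable lborel (indicator S :: real ^ 'm \<Rightarrow> real)" if "compact S" for S
    using that by (rule integrable_indicator_compact)
  have h_int: "integrable lborel (h i)" for i
    unfolding h_def by (intro Bochner_Integration.integrable_sum ind_int cgW)
  have h_integral: "(LINT x|lborel. h i x) = inverse lam * (\<Sum>j\<in>UNIV. real (card (T i j)) * \<mu> j)" for i
  proof -
    have "(LINT x|lborel. h i x) = (\<Sum>j\<in>UNIV. \<Sum>t\<in>T i j. measure lborel (g t ` W j))"
      unfolding h_def
      by (simp add: Bochner_Integration.integral_sum Bochner_Integration.integrable_sum ind_int cgW)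
    also have "\<dots> = (\<Sum>j\<in>UNIV. \<Sum>t\<in>T i j. inverse lam * \<mu> j)"
      unfolding g_def measure_affine_image[OF det0 cW] det \<mu>_def ..
    finally show ?thesis by (simp add: sum_distrib_left mult_ac)
  qed
  have le_h: "indicator (W i) x \<le> h i x" for i x
  proof (cases "x \<in> W i")
    case True
    then obtain j t where t: "t \<in> T i j" "x \<in> g t ` W j"
      unfolding Wi[of i] by blast
    have "1 \<le> (\<Sum>t\<in>T i j. indicator (g t ` W j) x :: real)"
      using t member_le_sum[of t "T i j" "\<lambda>t. indicator (g t ` W j) x :: real"] fin by simp
    also have "\<dots> \<le> h i x"
      unfolding h_def by (rule member_le_sum) (auto intro!: sum_nonneg)
    finally show ?thesis using True by simp
  next
    case False
    then show ?thesis by (auto simp: h_def intro!: sum_nonneg)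
  qed
  \<comment> \<open>\<open>\<delta> i\<close> is the volume lost to overlaps in \<open>W i\<close>,
    with multiplicity.\<close>
  define \<delta> where "\<delta> i = (LINT x|lborel. h i x - indicator (W i) x)" for i
  have \<delta>_nonneg: "\<delta> i \<ge> 0" for i
    unfolding \<delta>_def by (intro integral_nonneg_AE AE_I2) (simp add: le_h)
  have \<delta>_eq: "\<delta> i = inverse lam * (\<Sum>j\<in>UNIV. real (card (T i j)) * \<mu> j) - \<mu> i" for i
    unfolding \<delta>_def \<mu>_def
    by (simp add: Bochner_Integration.integral_diff[OF h_int ind_int[OF cW]] h_integral \<mu>_def)
  have "(\<Sum>i\<in>UNIV. u $ i * \<delta> i) \<le> 0"
  proof -
    \<comment> \<open>Replacing cardinalities by entries of \<open>M\<close> can only increase the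
      sum, as volumes and weights are nonnegative; the eigenvector equation then makes both terms
      cancel.\<close>
    have "(\<Sum>i\<in>UNIV. u $ i * \<delta> i)
        \<le> (\<Sum>i\<in>UNIV. u $ i * (inverse lam * (\<Sum>j\<in>UNIV. M $ i $ j * \<mu> j) - \<mu> i))"
      unfolding \<delta>_eq using card pos lam
      by (intro sum_mono mult_left_mono diff_right_mono mult_right_mono)
        (auto simp: \<mu>_def intro: less_imp_le)
    also have "\<dots> = inverse lam * (\<Sum>i\<in>UNIV. \<Sum>j\<in>UNIV. u $ i * M $ i $ j * \<mu> j) - (\<Sum>i\<in>UNIV. u $ i * \<mu> i)"
      by (simp add: right_diff_distrib sum_subtractf sum_distrib_left mult_ac)
    also have "(\<Sum>i\<in>UNIV. \<Sum>j\<in>UNIV. u $ i * M $ i $ j * \<mu> j) = (\<Sum>j\<in>UNIV. (\<Sum>i\<in>UNIV. u $ i * M $ i $ j) * \<mu> j)"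
      by (subst sum.swap) (simp add: sum_distrib_left sum_distrib_right mult_ac)
    also have "\<dots> = (\<Sum>j\<in>UNIV. lam * u $ j * \<mu> j)"
      using eig by (simp add: vector_matrix_mult_def vec_eq_iff)
    also have "inverse lam * \<dots> - (\<Sum>i\<in>UNIV. u $ i * \<mu> i) = 0"
      using lam by (simp add: sum_distrib_left field_simps)
    finally show ?thesis .
  qed
  moreover have nonneg: "0 \<le> u $ i * \<delta> i" for i
    using pos[of i] \<delta>_nonneg[of i] by simp
  ultimately have "(\<Sum>i\<in>UNIV. u $ i * \<delta> i) = 0"
    by (intro antisym sum_nonneg) auto
  then have "u $ i * \<delta> i = 0"
    using nonneg by (subst (asm) sum_nonneg_eq_0_iff) auto
  then have "\<delta> i = 0" using pos[of i] by simp
  then have "AE x in lborel. h i x - indicator (W i) x = 0"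
    unfolding \<delta>_def
    by (subst (asm) integral_nonneg_eq_0_iff_AE) (auto simp: le_h h_int ind_int[OF cW])
  then show ?thesis
    by (rule AE_mp) (simp add: h_def g_def)
qed

text \<open>The covering identity holds almost everywhere, the equation for \<open>f\<close> at
  every \<open>y\<close>. The second conjunct, the transform of the covering sum, links the
  two.\<close>

theorem proposition4p2:
  fixes \<rho> :: "'n::finite \<Rightarrow> 'n list"
    and lam c :: real
    and u len :: "real ^ 'n"
    and w :: "int \<Rightarrow> 'n"
    and d r s :: nat
    and \<kappa> :: "nat \<Rightarrow> real \<Rightarrow> real"
    and \<sigma> :: "nat \<Rightarrow> real \<Rightarrow> complex"
    and e :: "'m::finite \<Rightarrow> nat"
    and T :: "'n \<Rightarrow> 'n \<Rightarrow> real set"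
    and star :: "real \<Rightarrow> real ^ 'm"
    and Q R :: "real ^ 'm ^ 'm"
    and W :: "'n \<Rightarrow> (real ^ 'm) set"
    and f :: "real ^ 'm \<Rightarrow> complex ^ 'n"
    and B :: "real ^ 'm \<Rightarrow> complex ^ 'n ^ 'n"
  assumes "primitive_subst \<rho>"
    and "pf_eigenvalue (subst_matrix \<rho>) lam"
    and "pisot_unit lam"
    and "d = degree (min_poly lam)"
    and "d \<le> CARD('n)"
    and "u v* subst_matrix \<rho> = lam *s u" and "\<forall>i. u $ i > 0"
    and "c > 0" and "len = c *s u"
    and "w \<in> subst_hull \<rho>" and "generic_points lam (control_points len w)"
    and "T = tile_positions \<rho> len"
    and "embedding_list (rat_adjoin lam) r \<kappa> s \<sigma>"
    and "bij_betw e UNIV {1..d - 1}"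
    and "star = star_map e r \<kappa> \<sigma>"
    and "Q = star_matrix e r \<kappa> \<sigma> lam"
    and "window_system Q (\<lambda>i j. star ` T i j) W"
    and "f = (\<lambda>y. \<chi> i. inverse_fourier (indicator (W i)) y)"
    and "R = transpose Q"
    and "B = fourier_matrix T star"
  shows "(\<forall>i. AE x in lborel. (indicator (W i) x :: complex) =
           (\<Sum>j\<in>UNIV. \<Sum>t\<in>T i j. indicator ((\<lambda>z. Q *v z + star t) ` W j) x)) \<and>
    (\<forall>i y. inverse_fourier
           (\<lambda>x. \<Sum>j\<in>UNIV. \<Sum>t\<in>T i j. indicator ((\<lambda>z. Q *v z + star t) ` W j) x) y =
           (complex_of_real (inverse lam) *s (B y *v f (R *v y))) $ i) \<and>
    (\<forall>y. f y = complex_of_real (inverse lam) *s (B y *v f (R *v y))) \<and>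
    (\<forall>i. continuous_on UNIV (\<lambda>y. f y $ i))"
proof -
  let ?S = "\<lambda>i x. (\<Sum>j\<in>UNIV. \<Sum>t\<in>T i j. indicator ((\<lambda>z. Q *v z + star t) ` W j) x) :: complex"
  have lam: "lam > 0" "algebraic_int lam" "algebraic_int (inverse lam)"
    using \<open>pisot_unit lam\<close> by (auto simp: pisot_unit_def)
  have det: "\<bar>det Q\<bar> = inverse lam"
    using assms abs_det_star_matrix[OF lam] by simp
  then have det0: "det Q \<noteq> 0" using lam by auto
  have cW: "compact (W j)" for j
    using \<open>window_system _ _ W\<close> unfolding window_system_def by blast
  have cQW: "compact ((\<lambda>z. Q *v z + star t) ` W j)" for t j
    by (rule compact_affine_image[OF cW])
  have AE_real: "AE x in lborel. (indicator (W i) x :: real) =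
      (\<Sum>j\<in>UNIV. \<Sum>t\<in>T i j. indicator ((\<lambda>z. Q *v z + star t) ` W j) x)" for i
  proof (rule window_system_AE_disjoint[OF lam(1) det])
    show "finite (T i j)" "real (card (T i j)) \<le> subst_matrix \<rho> $ i $ j" for i j
      using card_tile_positions_le[of \<rho> len i j] \<open>T = _\<close> by (simp_all add: subst_matrix_def)
  qed (use assms in auto)
  have AE_complex: "AE x in lborel. (indicator (W i) x :: complex) = ?S i x" for i
    using AE_real[of i]
  proof (rule AE_mp, intro AE_I2 impI)
    fix x
    assume "(indicator (W i) x :: real) =
      (\<Sum>j\<in>UNIV. \<Sum>t\<in>T i j. indicator ((\<lambda>z. Q *v z + star t) ` W j) x)"
    then have "complex_of_real (indicator (W i) x) =
      of_real (\<Sum>j\<in>UNIV. \<Sum>t\<in>T i j. indicator ((\<lambda>z. Q *v z + star t) ` W j) x)"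
      by (rule arg_cong)
    then show "indicator (W i) x = ?S i x"
      by (simp add: of_real_indicator)
  qed
  have fourier_sum: "inverse_fourier (?S i) y = (complex_of_real (inverse lam) *s (B y *v f (R *v y))) $ i" for i y
  proof -
    \<comment> \<open>The pieces are compact, so every summand is integrable and the finite sums may
      leave the integral.\<close>
    have "inverse_fourier (?S i) y =
        (\<Sum>j\<in>UNIV. \<Sum>t\<in>T i j. inverse_fourier (indicator ((\<lambda>z. Q *v z + star t) ` W j)) y)"
      unfolding inverse_fourier_def sum_distrib_left
      by (simp only: Bochner_Integration.integral_sum Bochner_Integration.integrable_sum
          integrable_character_indicator[OF cQW])
    also have "\<dots> = (\<Sum>j\<in>UNIV. \<Sum>t\<in>T i j. complex_of_real (inverse lam) *
        (exp (2 * pi * \<i> * complex_of_real (star t \<bullet> y)) * inverse_fourier (indicator (W j)) (R *v y)))"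
      unfolding inverse_fourier_affine_image[OF det0 cW] det \<open>R = _\<close> ..
    also have "\<dots> = (complex_of_real (inverse lam) *s (B y *v f (R *v y))) $ i"
      by (simp add: \<open>B = _\<close> \<open>f = _\<close> fourier_matrix_def matrix_vector_mult_def
          sum_distrib_left sum_distrib_right)
    finally show ?thesis .
  qed
  have f_eq: "f y $ i = inverse_fourier (?S i) y" for y i
  proof -
    have [measurable]: "W i \<in> sets borel" "(\<lambda>z. Q *v z + star t) ` W j \<in> sets borel" for i t j
      using cW cQW by (auto intro: borel_compact)
    have [measurable]: "(\<lambda>x. exp (2 * pi * \<i> * complex_of_real (x \<bullet> y))) \<in> borel_measurable borel"
      by (intro borel_measurable_continuous_onI continuous_intros)
    \<comment> \<open>Integrals ignore null sets, so the almost everywhere identity gives equal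
      transforms at each frequency.\<close>
    have "inverse_fourier (indicator (W i)) y = inverse_fourier (?S i) y"
      unfolding inverse_fourier_def
    proof (rule integral_cong_AE)
      show "AE x in lborel. exp (2 * pi * \<i> * complex_of_real (x \<bullet> y)) * indicator (W i) x =
          exp (2 * pi * \<i> * complex_of_real (x \<bullet> y)) * ?S i x"
        using AE_complex[of i] by (rule AE_mp) simp
    qed measurable
    then show ?thesis by (simp add: \<open>f = _\<close>)
  qed
  have cont: "continuous_on UNIV (\<lambda>y. f y $ i)" for i
    using continuous_on_inverse_fourier_indicator[OF cW] by (simp add: \<open>f = _\<close>)
  show ?thesis
    using AE_complex fourier_sum f_eq cont by (auto simp: vec_eq_iff simp del: vector_smult_component)
qed

end
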